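(* Let $\Gamma$ be a finite simplicial graph that does not contain triangles (i.e. no three pairwise adjacent vertices) and let $G = A(\Gamma)$ be the right-angled Artin group with defining graph $\Gamma$. Then every non-trivial element $g \in G$ satisfies $$\operatorname{scl}(g) \ \ge \ \frac{1}{20}.$$
   Context: A finite simplicial graph $\Gamma$ (no loops, no multiple edges) has vertex set $V(\Gamma)$ and edge set $E(\Gamma)$. The right-angled Artin group $A(\Gamma)$ is the group with presentation $\langle\, a \in V(\Gamma) \mid [a,b]=1 \text{ if } (a,b) \in E(\Gamma)\,\rangle$. Commutator length: given a group $G$, let $X$ be a path connected space with fundamental group $G$. For $g \in [G,G]$, $\operatorname{cl}(g) = \min_S \operatorname{genus}(S)$, the minimum being over all continuous maps $f \colon S \to X$ where $S$ is a compact, connected, oriented surface with one boundary component and $f|_{\partial S} \colon \partial S \to X$ represents the conjugacy class of $g$ in $\pi_1(X)$. Stable commutator length: for $g \in [G,G]$, $\operatorname{scl}(g) = \lim_{n \to \infty} \operatorname{cl}(g^n)/n$ (the limit exists). If $g^n \in [G,G]$ for some $n \ge 1$, then $\operatorname{scl}(g) = \operatorname{scl}(g^n)/n$ (well defined and consistent with the previous definition). If $g^n \notin [G,G]$ for every $n \neq 0$, then $\operatorname{scl}(g) = \infty$ by convention. *)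

theory Defs
  imports "HOL-Analysis.Analysis" "HOL-Algebra.Generated_Groups"
begin

section \<open>Groups given by presentations\<close>

text \<open>A word over the generating set \<open>V\<close> is a list of letters \<open>(a, e)\<close>; the letter
  \<open>(a, True)\<close> stands for \<open>a\<close> and \<open>(a, False)\<close> for its formal inverse.\<close>

type_synonym 'v word = "('v \<times> bool) list"

abbreviation words :: "'v set \<Rightarrow> 'v word set" where
  "words V \<equiv> lists (V \<times> UNIV)"

inductive word_eq :: "'v set \<Rightarrow> 'v word set \<Rightarrow> 'v word \<Rightarrow> 'v word \<Rightarrow> bool"
  for V :: "'v set" and R :: "'v word set" where
  refl: "w \<in> words V \<Longrightarrow> word_eq V R w w"
| sym: "word_eq V R u w \<Longrightarrow> word_eq V R w u"
| trans: "word_eq V R u v \<Longrightarrow> word_eq V R v w \<Longrightarrow> word_eq V R u w"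
| cancel: "u \<in> words V \<Longrightarrow> w \<in> words V \<Longrightarrow> a \<in> V
            \<Longrightarrow> word_eq V R (u @ [(a, e), (a, \<not> e)] @ w) (u @ w)"
| relator: "u \<in> words V \<Longrightarrow> w \<in> words V \<Longrightarrow> r \<in> R \<Longrightarrow> r \<in> words V
            \<Longrightarrow> word_eq V R (u @ r @ w) (u @ w)"

definition presented_group :: "'v set \<Rightarrow> 'v word set \<Rightarrow> 'v word set monoid" where
  "presented_group V R =
    \<lparr>carrier = words V // {(u, w). word_eq V R u w},
     mult = (\<lambda>A B. {w. \<exists>u\<in>A. \<exists>v\<in>B. word_eq V R (u @ v) w}),
     one = {w. word_eq V R [] w}\<rparr>"


section \<open>Right-angled Artin groups\<close>

definition finite_simplicial_graph :: "'v set \<Rightarrow> 'v set set \<Rightarrow> bool" where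
  "finite_simplicial_graph V E \<longleftrightarrow> finite V \<and> (\<forall>e\<in>E. e \<subseteq> V \<and> card e = 2)"

definition triangle_free :: "'v set set \<Rightarrow> bool" where
  "triangle_free E \<longleftrightarrow> (\<nexists>a b c. {a, b} \<in> E \<and> {b, c} \<in> E \<and> {a, c} \<in> E)"

definition raag :: "'v set \<Rightarrow> 'v set set \<Rightarrow> 'v word set monoid" where
  "raag V E = presented_group V
     {[(a, True), (b, True), (a, False), (b, False)] | a b. {a, b} \<in> E}"


section \<open>The fundamental group\<close>

definition loop_class :: "'x::topological_space set \<Rightarrow> (real \<Rightarrow> 'x) \<Rightarrow> (real \<Rightarrow> 'x) set" where
  "loop_class X p = {q. homotopic_paths X p q}"

definition fundamental_group ::
    "'x::topological_space set \<Rightarrow> 'x \<Rightarrow> (real \<Rightarrow> 'x) set monoid" where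
  "fundamental_group X x0 =
    \<lparr>carrier = {loop_class X p | p.
       path p \<and> path_image p \<subseteq> X \<and> pathstart p = x0 \<and> pathfinish p = x0},
     mult = (\<lambda>A B. {r. \<exists>p\<in>A. \<exists>q\<in>B. homotopic_paths X (p +++ q) r}),
     one = loop_class X (\<lambda>_. x0)\<rparr>"


section \<open>Compact connected oriented surfaces with one boundary component\<close>

text \<open>The closed unit disc is regarded as a polygon with \<open>n\<close> sides, its boundary circle being
  divided into \<open>n\<close> equal arcs; side \<open>k < n\<close> is parametrised counterclockwise by \<open>s \<in> [0, 1]\<close>.\<close>

definition polygon_side :: "nat \<Rightarrow> nat \<Rightarrow> real \<Rightarrow> complex" where
  "polygon_side n k s = cis (2 * pi * ((real k + s) / real n))"

text \<open>The sides of the \<open>(4h+1)\<close>-gon are labelled counterclockwise by the word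
  \<open>a\<^sub>1 b\<^sub>1 a\<^sub>1\<^sup>-\<^sup>1 b\<^sub>1\<^sup>-\<^sup>1 \<dots> a\<^sub>h b\<^sub>h a\<^sub>h\<^sup>-\<^sup>1 b\<^sub>h\<^sup>-\<^sup>1 c\<close>. The sides carrying the same letter
  are glued, with their directions reversed; the last side \<open>c\<close> stays free.\<close>

inductive side_pairing :: "nat \<Rightarrow> complex \<Rightarrow> complex \<Rightarrow> bool" for h :: nat where
  a: "i < h \<Longrightarrow> s \<in> {0..1} \<Longrightarrow>
      side_pairing h (polygon_side (4*h+1) (4*i) s) (polygon_side (4*h+1) (4*i+2) (1 - s))"
| b: "i < h \<Longrightarrow> s \<in> {0..1} \<Longrightarrow>
      side_pairing h (polygon_side (4*h+1) (4*i+1) s) (polygon_side (4*h+1) (4*i+3) (1 - s))"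

text \<open>\<open>oriented_surface h S q\<close>: the space \<open>S\<close> is a compact, connected, oriented surface of genus
  \<open>h\<close> with one boundary component, in the form provided by the classification of surfaces (a
  connected sum of \<open>h\<close> tori with an open disc removed). The map \<open>q\<close> exhibits \<open>S\<close>, up to
  homeomorphism, as the polygon with its sides glued, and the orientation of \<open>S\<close> is the one
  coming from the disc. All corners of the polygon are glued to one point, so the free side
  becomes a circle, the boundary of \<open>S\<close>, traversed once in the boundary orientation by
  \<open>boundary_loop h q\<close>. For \<open>h = 0\<close> the surface is a disc.\<close>

definition oriented_surface :: "nat \<Rightarrow> 's topology \<Rightarrow> (complex \<Rightarrow> 's) \<Rightarrow> bool" where
  "oriented_surface h S q \<longleftrightarrow>
     quotient_map (top_of_set (cball 0 1)) S q \<and>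
     (\<forall>x\<in>cball 0 1. \<forall>y\<in>cball 0 1. q x = q y \<longleftrightarrow> equivclp (side_pairing h) x y)"

lemma oriented_surface_compact_connected:
  assumes "oriented_surface h S q"
  shows "compact_space S" "connected_space S"
proof -
  have q: "quotient_map (top_of_set (cball 0 1)) S q"
    using assms unfolding oriented_surface_def by auto
  then have c: "continuous_map (top_of_set (cball (0::complex) 1)) S q" and s: "q ` topspace (top_of_set (cball 0 1)) = topspace S"
    using quotient_imp_continuous_map quotient_imp_surjective_map by blast+
  have "compactin (top_of_set (cball (0::complex) 1)) (topspace (top_of_set (cball 0 1)))"
    by (simp add: compactin_subtopology)
  then show "compact_space S" using image_compactin[OF _ c] s unfolding compact_space_def by metis
  have "connectedin (top_of_set (cball (0::complex) 1)) (topspace (top_of_set (cball 0 1)))"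
    by (simp add: connectedin_subtopology)
  then show "connected_space S" using connectedin_continuous_map_image[OF c] s
    unfolding connectedin_topspace[symmetric] by metis
qed

definition boundary_loop :: "nat \<Rightarrow> (complex \<Rightarrow> 's) \<Rightarrow> real \<Rightarrow> 's" where
  "boundary_loop h q = (\<lambda>s. q (polygon_side (4*h+1) (4*h) s))"


section \<open>Commutator length and stable commutator length\<close>

text \<open>Throughout, \<open>X\<close> is a path connected space and \<open>\<phi>\<close> an isomorphism from the group \<open>G\<close> in
  question to the fundamental group of \<open>X\<close>, so that \<open>\<phi> g\<close> is a homotopy class of based loops.
  The boundary of a surface represents the conjugacy class of \<open>g\<close> when it is freely homotopic to
  a loop in \<open>\<phi> g\<close>. The lengths below do not depend on the choice of \<open>X\<close> and \<open>\<phi>\<close>. Up to homeomorphism, the points of a compact surface may be taken from any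
  type with the cardinality of the continuum, here \<open>complex\<close>; the topology on them is arbitrary
  and unrelated to that of the plane.\<close>

definition bounds_genus :: "'x::topological_space set \<Rightarrow> ('g \<Rightarrow> (real \<Rightarrow> 'x) set) \<Rightarrow> 'g \<Rightarrow> nat \<Rightarrow> bool"
  where
  "bounds_genus X \<phi> g h \<longleftrightarrow>
     (\<exists>(S :: complex topology) q f.
        oriented_surface h S q \<and> continuous_map S (top_of_set X) f \<and>
        (\<exists>p\<in>\<phi> g. homotopic_loops X (f \<circ> boundary_loop h q) p))"

text \<open>The value is meaningful for \<open>g\<close> in the commutator subgroup only.\<close>

definition commutator_length ::
    "'x::topological_space set \<Rightarrow> ('g \<Rightarrow> (real \<Rightarrow> 'x) set) \<Rightarrow> 'g \<Rightarrow> nat" where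
  "commutator_length X \<phi> g = (LEAST h. bounds_genus X \<phi> g h)"

definition scl_derived ::
    "('g, 'm) monoid_scheme \<Rightarrow> 'x::topological_space set \<Rightarrow> ('g \<Rightarrow> (real \<Rightarrow> 'x) set) \<Rightarrow> 'g \<Rightarrow> real"
  where
  "scl_derived G X \<phi> g = lim (\<lambda>n. real (commutator_length X \<phi> (g [^]\<^bsub>G\<^esub> n)) / real n)"

definition scl ::
    "('g, 'm) monoid_scheme \<Rightarrow> 'x::topological_space set \<Rightarrow> ('g \<Rightarrow> (real \<Rightarrow> 'x) set) \<Rightarrow> 'g \<Rightarrow> ereal"
  where
  "scl G X \<phi> g =
     (if \<exists>n\<ge>1. g [^]\<^bsub>G\<^esub> (n::nat) \<in> derived G (carrier G)
      then let n = (LEAST n::nat. n \<ge> 1 \<and> g [^]\<^bsub>G\<^esub> n \<in> derived G (carrier G))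
           in ereal (scl_derived G X \<phi> (g [^]\<^bsub>G\<^esub> n) / real n)
      else \<infinity>)"

end

theory Submission
  imports Defs
begin

text \<open>
  Why the bound holds. A function \<open>H\<close> on a group with \<open>H 1 = 0\<close> and
  \<open>\<bar>H (x y) - H x - H y\<bar> \<le> D\<close> is at most \<open>4 D m\<close> on a product of \<open>m\<close> commutators
  (\<open>quasimorphism_comm_prods\<close>). If moreover \<open>H (g\<^sup>n) \<ge> n\<close> for all \<open>n\<close>, then the commutator
  length of \<open>g\<^sup>n\<close> is at least \<open>n / (4 D)\<close>. For every nontrivial \<open>g\<close> in a right-angled Artin
  group such a function is found with \<open>D = 3\<close> for some conjugate of \<open>g\<close>; this gives
  \<open>commutator_gap\<close> and stable commutator length at least \<open>1/12\<close>.

  The function is a counting quasimorphism in the sense of Brooks, Epstein and Fujiwara. For a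
  vertex \<open>v\<close> the group is an HNN extension with stable letter \<open>v\<close> over the subgroup \<open>L v\<close>
  generated by the link of \<open>v\<close>, so it acts on a tree whose edges are the cosets of \<open>L v\<close>. The
  tree itself is never built. Reading a word and writing down, at each letter \<open>v\<close> or \<open>v\<^sup>-\<^sup>1\<close>,
  the coset being crossed and the direction of the crossing gives an element of the free group on
  the cosets; it depends only on the group element (\<open>word_eq_crossings\<close>), it satisfies
  \<open>P (x y) = P x \<cdot> x (P y)\<close> (\<open>crossing_path_mult\<close>), and its reduced form is the edge path from
  the base vertex to its image under \<open>x\<close>. The quasimorphism counts disjoint translates of a fixed
  path in \<open>P x\<close>, minus disjoint translates of the reversed path. Its defect is at most \<open>3\<close>,
  because the paths of \<open>x\<close>, \<open>y\<close> and \<open>x y\<close> form a tripod, and cutting each of the three sides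
  at the centre costs at most \<open>1\<close> (\<open>tally_nf_append\<close>).

  Given \<open>g\<close>, take a shortest word \<open>w\<close> in its conjugacy class, let \<open>v\<close> be its first letter, and
  count translates of the path \<open>\<gamma>\<close> of \<open>w\<close>. The path of \<open>w\<^sup>n\<close> is the concatenation of
  \<open>\<gamma>, w \<gamma>, w\<^sup>2 \<gamma>, \<dots>\<close>, which is already reduced (\<open>reduced_axis\<close>), so it contains \<open>n\<close> disjoint
  translates of \<open>\<gamma>\<close>. It contains no translate of the reversed path (\<open>axis_no_inverse\<close>): such a
  translate would reflect the periodic sequence of crossings; a reflection changes all signs, so
  it fixes no crossing and has to interchange two consecutive ones; a group element that
  interchanges two consecutive edges of a geodesic has, up to conjugation, its square in \<open>L v\<close>,
  hence lies in \<open>L v\<close> itself (\<open>parabolic_square_closed\<close>), and then the two edges are equal,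
  which contradicts reducedness.

  On the topological side, a surface of genus \<open>h\<close> with boundary in the class of \<open>x\<close> exists exactly
  if \<open>x\<close> is a product of \<open>h\<close> commutators (\<open>bounds_genus_iff_comm_prods\<close>): cutting the surface open
  turns it into a disc whose boundary reads a product of commutators followed by the boundary
  loop, and a loop extends over the disc if and only if it is null-homotopic. Hence the commutator
  length is subadditive on powers, the limit that defines stable commutator length exists
  (\<open>fekete\<close>), and the lower bound passes to the limit.
\<close>

section \<open>Free reduction\<close>

definition flip :: "'a \<times> bool \<Rightarrow> 'a \<times> bool" where
  "flip x = (fst x, \<not> snd x)"

lemma flip_simps [simp]: "flip (a, e) = (a, \<not> e)" "flip (flip x) = x" "fst (flip x) = fst x"
    "snd (flip x) = (\<not> snd x)" "x \<noteq> flip x" "flip x \<noteq> x"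
  by (auto simp: flip_def prod_eq_iff)

definition inv_word :: "('a \<times> bool) list \<Rightarrow> ('a \<times> bool) list" where
  "inv_word w = rev (map flip w)"

lemma inv_word_simps [simp]: "inv_word [] = []" "inv_word (x # w) = inv_word w @ [flip x]"
    "inv_word (u @ w) = inv_word w @ inv_word u" "inv_word (inv_word w) = w"
    "length (inv_word w) = length w" "inv_word w = [] \<longleftrightarrow> w = []"
  by (auto simp: inv_word_def rev_map comp_def)

abbreviation reduced :: "('a \<times> bool) list \<Rightarrow> bool" where
  "reduced \<equiv> successively (\<lambda>x y. y \<noteq> flip x)"

lemma successivelyI:
  "(\<And>P x y Q. w = P @ x # y # Q \<Longrightarrow> R x y) \<Longrightarrow> successively R w"
proof (induction w)
  case (Cons a w)
  have "successively R w"
    by (rule Cons.IH) (use Cons.prems in \<open>metis append_Cons\<close>)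
  moreover have "R a (hd w)" if "w \<noteq> []"
    using Cons.prems[of "[]" a "hd w" "tl w"] that by simp
  ultimately show ?case by (auto simp: successively_Cons)
qed simp

text \<open>Free reduction is computed by letting letters act on reduced words from the left. Each letter
  acts as a permutation of the reduced words (\<open>push_flip\<close>), which yields uniqueness of reduced forms
  without a confluence argument.\<close>

fun push :: "'a \<times> bool \<Rightarrow> ('a \<times> bool) list \<Rightarrow> ('a \<times> bool) list" where
  "push x [] = [x]"
| "push x (y # w) = (if y = flip x then w else x # y # w)"

definition nf :: "('a \<times> bool) list \<Rightarrow> ('a \<times> bool) list" where
  "nf w = foldr push w []"

lemma nf_Nil [simp]: "nf [] = []" by (simp add: nf_def)

lemma reduced_push: "reduced w \<Longrightarrow> reduced (push x w)"
  by (cases w; cases "tl w") (auto simp: successively_Cons)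

lemma push_flip: "reduced w \<Longrightarrow> push x (push (flip x) w) = w"
  by (cases w; cases "tl w") (auto simp: successively_Cons)

lemma reduced_foldr_push: "reduced r \<Longrightarrow> reduced (foldr push w r)"
  by (induction w) (auto intro: reduced_push)

lemma reduced_nf [simp]: "reduced (nf w)"
  unfolding nf_def by (rule reduced_foldr_push) simp

lemma nf_reduced: "reduced w \<Longrightarrow> nf w = w"
proof (induction w)
  case (Cons x w)
  then have "nf (x # w) = push x w" by (auto simp: nf_def successively_Cons)
  then show ?case using Cons.prems by (cases w) (auto simp: successively_Cons)
qed simp

lemma foldr_push_push: "reduced r \<Longrightarrow> foldr push (push x w) r = push x (foldr push w r)"
  by (cases w) (auto simp: push_flip reduced_foldr_push)

lemma foldr_push_nf: "reduced r \<Longrightarrow> foldr push (nf w) r = foldr push w r"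
proof (induction w)
  case (Cons x w)
  then have "foldr push (nf (x # w)) r = push x (foldr push (nf w) r)"
    by (simp add: nf_def foldr_push_push)
  then show ?case using Cons by simp
qed simp

lemma nf_append: "nf (u @ w) = foldr push u (nf w)"
  by (simp add: nf_def)

lemma nf_nf_append: "nf (nf u @ nf w) = nf (u @ w)"
  by (simp add: nf_append foldr_push_nf nf_reduced)

lemma nf_cong_append: "nf u = nf u' \<Longrightarrow> nf w = nf w' \<Longrightarrow> nf (u @ w) = nf (u' @ w')"
  by (metis nf_nf_append)

lemma nf_cancel: "nf (u @ x # flip x # w) = nf (u @ w)"
  by (simp add: nf_append nf_def push_flip reduced_foldr_push)

text \<open>The relabelling has to be injective only on the letters that occur; translations of cosets,
  to which this is applied, are injective on subsets of the carrier but not on all sets.\<close>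

lemma nf_map:
  assumes "inj_on h A" "fst ` set w \<subseteq> A"
  shows "nf (map (apfst h) w) = map (apfst h) (nf w) \<and> set (nf w) \<subseteq> set w"
  using assms(2)
proof (induction w)
  case (Cons x w)
  then have IH: "nf (map (apfst h) w) = map (apfst h) (nf w)" "set (nf w) \<subseteq> set w" by auto
  have "push (apfst h x) (map (apfst h) (nf w)) = map (apfst h) (push x (nf w))"
  proof (cases "nf w")
    case (Cons y r)
    then have "fst y \<in> A" "fst x \<in> A" using IH(2) Cons.prems by auto
    then have "apfst h y = flip (apfst h x) \<longleftrightarrow> y = flip x"
      using assms(1) by (auto simp: prod_eq_iff inj_on_eq_iff)
    then show ?thesis using Cons by auto
  qed simp
  moreover have "set (push x (nf w)) \<subseteq> insert x (set (nf w))" by (cases "nf w") auto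
  ultimately show ?case using IH by (auto simp: nf_def)
qed simp

text \<open>The geodesics \<open>p\<close>, \<open>q\<close> and their product span a tripod in the tree of reduced words;
  \<open>s\<close> is the leg along which \<open>p\<close> and \<open>q\<close> backtrack.\<close>

lemma nf_tripod:
  assumes "reduced p" "reduced q"
  shows "\<exists>a s b. p = a @ s \<and> q = inv_word s @ b \<and> nf (p @ q) = a @ b"
  using assms
proof (induction p arbitrary: q rule: rev_induct)
  case Nil
  then show ?case by (auto simp: nf_reduced)
next
  case (snoc x p)
  show ?case
  proof (cases "\<exists>q'. q = flip x # q'")
    case True
    then obtain q' where q: "q = flip x # q'" by blast
    have "reduced p" "reduced q'"
      using snoc.prems q by (auto simp: successively_append_iff successively_Cons)
    then obtain a s b where *: "p = a @ s" "q' = inv_word s @ b" "nf (p @ q') = a @ b"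
      using snoc.IH by blast
    have "p @ [x] = a @ (s @ [x])" "q = inv_word (s @ [x]) @ b" using * q by auto
    moreover have "nf ((p @ [x]) @ q) = a @ b" using *(3) nf_cancel[of p x q'] q by simp
    ultimately show ?thesis by blast
  next
    case False
    have "reduced ((p @ [x]) @ q)"
      using snoc.prems False by (cases q) (auto simp: successively_append_iff)
    then show ?thesis
      by (intro exI[of _ "p @ [x]"] exI[of _ "[]"] exI[of _ q]) (auto simp: nf_reduced)
  qed
qed

section \<open>Counting disjoint factors\<close>

fun packs :: "'a list set \<Rightarrow> 'a list \<Rightarrow> nat \<Rightarrow> bool" where
  "packs Q w 0 \<longleftrightarrow> True"
| "packs Q w (Suc n) \<longleftrightarrow> (\<exists>x q y. w = x @ q @ y \<and> q \<in> Q \<and> packs Q y n)"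

definition packing_number :: "'a list set \<Rightarrow> 'a list \<Rightarrow> nat" where
  "packing_number Q w = Max {n. packs Q w n}"

lemma packs_append_left: "packs Q w n \<Longrightarrow> packs Q (u @ w) n"
  by (cases n) (auto, metis append.assoc)

lemma packs_append: "packs Q x i \<Longrightarrow> packs Q y j \<Longrightarrow> packs Q (x @ y) (i + j)"
proof (induction i arbitrary: x)
  case (Suc i)
  then obtain a q b where "x = a @ q @ b" "q \<in> Q" "packs Q b i" by auto
  with Suc show ?case by auto
qed (simp add: packs_append_left)

text \<open>Only one of the disjoint factors can straddle the cut point.\<close>

lemma packs_split: "packs Q (x @ y) n \<Longrightarrow> \<exists>i j. packs Q x i \<and> packs Q y j \<and> n \<le> i + j + 1"
proof (induction n arbitrary: x)
  case 0
  show ?case by (metis le0 packs.simps(1))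
next
  case (Suc n)
  then obtain a q b where 1: "x @ y = a @ q @ b" "q \<in> Q" "packs Q b n" by auto
  \<comment> \<open>either the first factor lies inside the left part, or all later ones lie inside the right part\<close>
  then have "(\<exists>x'. x = a @ q @ x' \<and> b = x' @ y) \<or> (\<exists>y'. y = y' @ b)"
    by (auto simp: append_eq_append_conv2) (metis append.assoc)+
  then show ?case
  proof
    assume "\<exists>x'. x = a @ q @ x' \<and> b = x' @ y"
    then obtain x' where x': "x = a @ q @ x'" "b = x' @ y" by blast
    with Suc.IH 1(3) obtain i j where "packs Q x' i" "packs Q y j" "n \<le> i + j + 1" by blast
    then have "packs Q x (Suc i)" "packs Q y j" "Suc n \<le> Suc i + j + 1" using x' 1(2) by auto
    then show ?thesis by blast
  next
    assume "\<exists>y'. y = y' @ b"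
    then have "packs Q y n" using 1(3) packs_append_left by blast
    then show ?thesis by (intro exI[of _ 0] exI[of _ n]) auto
  qed
qed

lemma packs_le_length: "[] \<notin> Q \<Longrightarrow> packs Q w n \<Longrightarrow> n \<le> length w"
proof (induction n arbitrary: w)
  case (Suc n)
  then obtain x q y where w: "w = x @ q @ y" "q \<in> Q" "packs Q y n" by auto
  then have "n \<le> length y" "q \<noteq> []" using Suc by auto
  then show ?case using w(1) by (cases q) auto
qed simp

lemma finite_packs: "[] \<notin> Q \<Longrightarrow> finite {n. packs Q w n}"
  by (rule finite_subset[of _ "{..length w}"]) (auto simp: packs_le_length)

lemma le_packing_number: "[] \<notin> Q \<Longrightarrow> packs Q w n \<Longrightarrow> n \<le> packing_number Q w"
  unfolding packing_number_def by (simp add: finite_packs)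

lemma packs_packing_number: "[] \<notin> Q \<Longrightarrow> packs Q w (packing_number Q w)"
  unfolding packing_number_def using Max_in[OF finite_packs, of Q w]
  by (metis empty_iff mem_Collect_eq packs.simps(1))

lemma packing_number_append:
  assumes "[] \<notin> Q"
  shows "packing_number Q x + packing_number Q y \<le> packing_number Q (x @ y)"
    and "packing_number Q (x @ y) \<le> packing_number Q x + packing_number Q y + 1"
proof -
  show "packing_number Q x + packing_number Q y \<le> packing_number Q (x @ y)"
    using assms by (intro le_packing_number packs_append packs_packing_number)
  obtain i j where "packs Q x i" "packs Q y j" "packing_number Q (x @ y) \<le> i + j + 1"
    using packs_split[OF packs_packing_number[OF assms]] by blast
  then show "packing_number Q (x @ y) \<le> packing_number Q x + packing_number Q y + 1"
    using le_packing_number[OF assms] by (metis add_le_mono add_le_mono1 le_trans)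
qed

lemma packs_image:
  assumes "packs Q w n" "\<And>u v. f (u @ v) = f u @ f v"
  shows "packs (f ` Q) (f w) n"
  using assms(1)
proof (induction n arbitrary: w)
  case (Suc n)
  then obtain x q y where w: "w = x @ q @ y" "q \<in> Q" "packs Q y n" by auto
  then have "f w = f x @ f q @ f y" "packs (f ` Q) (f y) n" using Suc assms(2) by auto
  then show ?case using w(2) by auto
qed simp

lemma packs_inv_word: "packs Q w n \<Longrightarrow> packs (inv_word ` Q) (inv_word w) n"
proof (induction n arbitrary: w)
  case (Suc n)
  then obtain x q y where w: "w = x @ q @ y" "q \<in> Q" "packs Q y n" by auto
  have "packs (inv_word ` Q) (inv_word q @ inv_word x) (Suc 0)"
    using w(2) by (simp, metis append_Nil imageI)
  then have "packs (inv_word ` Q) (inv_word y @ inv_word q @ inv_word x) (n + Suc 0)"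
    using Suc.IH[OF w(3)] packs_append by blast
  then show ?case using w(1) by simp
qed simp

lemma inv_word_image_image [simp]: "inv_word ` inv_word ` Q = Q"
  by (simp add: image_image)

lemma packing_number_inv_word: "packing_number (inv_word ` Q) (inv_word w) = packing_number Q w"
proof -
  have "packs (inv_word ` Q) (inv_word w) n = packs Q w n" for n
    using packs_inv_word[of Q w n] packs_inv_word[of "inv_word ` Q" "inv_word w" n] by auto
  then show ?thesis by (simp add: packing_number_def)
qed

text \<open>The counting function of Brooks, for a whole set \<open>Q\<close> of patterns at once. In the application
  \<open>Q\<close> is the set of all translates of one path, which makes the count invariant under translation.\<close>

definition tally :: "('a \<times> bool) list set \<Rightarrow> ('a \<times> bool) list \<Rightarrow> int" where
  "tally Q w = int (packing_number Q w) - int (packing_number (inv_word ` Q) w)"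

lemma tally_inv_word: "tally Q (inv_word w) = - tally Q w"
  using packing_number_inv_word[of Q w] packing_number_inv_word[of "inv_word ` Q" w]
  by (simp add: tally_def)

lemma tally_append:
  assumes "[] \<notin> Q"
  shows "\<bar>tally Q (x @ y) - tally Q x - tally Q y\<bar> \<le> 1"
proof -
  have Q': "[] \<notin> inv_word ` Q" using assms by (metis imageE inv_word_simps(6))
  show ?thesis
    using packing_number_append[OF assms, of x y] packing_number_append[OF Q', of x y]
    unfolding tally_def by linarith
qed

text \<open>Each side of the tripod is a concatenation of two legs, which costs at most \<open>1\<close> by
  \<open>tally_append\<close>; the legs themselves contribute nothing, since every leg is read once in each
  direction.\<close>

lemma tally_nf_append:
  assumes "[] \<notin> Q" "reduced p" "reduced q"
  shows "\<bar>tally Q (nf (p @ q)) - tally Q p - tally Q q\<bar> \<le> 3"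
proof -
  obtain a s b where *: "p = a @ s" "q = inv_word s @ b" "nf (p @ q) = a @ b"
    using nf_tripod[OF assms(2,3)] by blast
  show ?thesis
    unfolding *(3) unfolding *(1,2)
    using tally_append[OF assms(1), of a s] tally_append[OF assms(1), of a b]
      tally_append[OF assms(1), of "inv_word s" b] tally_inv_word[of Q s] by linarith
qed

section \<open>Products of commutators\<close>

abbreviation (in group) comm :: "'a \<Rightarrow> 'a \<Rightarrow> 'a" where
  "comm x y \<equiv> x \<otimes> y \<otimes> inv x \<otimes> inv y"

fun (in monoid) comm_prod :: "(nat \<Rightarrow> 'a) \<Rightarrow> (nat \<Rightarrow> 'a) \<Rightarrow> nat \<Rightarrow> 'a" where
  "comm_prod a b 0 = \<one>"
| "comm_prod a b (Suc n) = comm_prod a b n \<otimes> (a n \<otimes> b n \<otimes> inv (a n) \<otimes> inv (b n))"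

text \<open>The sequences are required to lie in the carrier at all indices, not only below \<open>n\<close>;
  in a group this is no restriction, since the values beyond \<open>n\<close> can be changed to \<open>\<one>\<close>.\<close>

definition (in monoid) comm_prods :: "nat \<Rightarrow> 'a set" where
  "comm_prods n = {comm_prod a b n | a b. range a \<subseteq> carrier G \<and> range b \<subseteq> carrier G}"

context group begin

lemma inv_cancel_left [simp]:
  assumes "x \<in> carrier G" "z \<in> carrier G"
  shows "inv x \<otimes> (x \<otimes> z) = z" "x \<otimes> (inv x \<otimes> z) = z"
  using assms by (simp_all flip: m_assoc)

lemma comm_prod_closed [simp]:
  "range a \<subseteq> carrier G \<Longrightarrow> range b \<subseteq> carrier G \<Longrightarrow> comm_prod a b n \<in> carrier G"
  by (induction n) (auto simp: image_subset_iff)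

lemma comm_prod_cong:
  "(\<And>i. i < n \<Longrightarrow> a i = a' i) \<Longrightarrow> (\<And>i. i < n \<Longrightarrow> b i = b' i) \<Longrightarrow> comm_prod a b n = comm_prod a' b' n"
  by (induction n) auto

lemma comm_prods_subset: "comm_prods n \<subseteq> carrier G"
  by (auto simp: comm_prods_def)

lemma comm_prodsI:
  "range a \<subseteq> carrier G \<Longrightarrow> range b \<subseteq> carrier G \<Longrightarrow> x = comm_prod a b n \<Longrightarrow> x \<in> comm_prods n"
  unfolding comm_prods_def by blast

lemma comm_prodsE:
  assumes "x \<in> comm_prods n"
  obtains a b where "range a \<subseteq> carrier G" "range b \<subseteq> carrier G" "x = comm_prod a b n"
  using assms unfolding comm_prods_def by blast

lemma comm_prods_mult:
  assumes "x \<in> comm_prods m" "y \<in> comm_prods n"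
  shows "x \<otimes> y \<in> comm_prods (m + n)"
proof -
  obtain a b c d where ab: "range a \<subseteq> carrier G" "range b \<subseteq> carrier G" "x = comm_prod a b m"
    and cd: "range c \<subseteq> carrier G" "range d \<subseteq> carrier G" "y = comm_prod c d n"
    using assms by (auto elim!: comm_prodsE)
  define a' b' where "a' = (\<lambda>i. if i < m then a i else c (i - m))"
    and "b' = (\<lambda>i. if i < m then b i else d (i - m))"
  have r: "range a' \<subseteq> carrier G" "range b' \<subseteq> carrier G"
    using ab cd by (auto simp: a'_def b'_def image_subset_iff)
  have "comm_prod a' b' (m + k) = x \<otimes> comm_prod c d k" for k
  proof (induction k)
    case 0
    show ?case using ab by (auto simp: a'_def b'_def intro: comm_prod_cong)
  next
    case (Suc k)
    have "a' (m + k) = c k" "b' (m + k) = d k" "c k \<in> carrier G" "d k \<in> carrier G"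
      using cd by (auto simp: a'_def b'_def)
    then show ?case using Suc ab cd by (simp add: m_assoc)
  qed
  then show ?thesis using r cd by (intro comm_prodsI[of a' b']) simp_all
qed

lemma one_comm_prods: "\<one> \<in> comm_prods 0"
  by (auto simp: comm_prods_def intro!: exI[of _ "\<lambda>_. \<one>"])

lemma comm_in_comm_prods:
  assumes "x \<in> carrier G" "y \<in> carrier G"
  shows "comm x y \<in> comm_prods 1"
proof -
  have "comm x y = comm_prod (\<lambda>_. x) (\<lambda>_. y) 1" using assms by simp
  then show ?thesis using assms by (intro comm_prodsI[of "\<lambda>_. x" "\<lambda>_. y"]) auto
qed

lemma conj_mult:
  assumes "k \<in> carrier G" "x \<in> carrier G" "y \<in> carrier G"
  shows "k \<otimes> (x \<otimes> y) \<otimes> inv k = (k \<otimes> x \<otimes> inv k) \<otimes> (k \<otimes> y \<otimes> inv k)"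
  using assms by (simp add: m_assoc)

lemma comm_prods_inv: "x \<in> comm_prods n \<Longrightarrow> inv x \<in> comm_prods n"
proof -
  have "inv (comm_prod a b n) \<in> comm_prods n" if "range a \<subseteq> carrier G" "range b \<subseteq> carrier G" for a b
  proof (induction n)
    case (Suc n)
    have ab: "a n \<in> carrier G" "b n \<in> carrier G" using that by auto
    then have "inv (comm_prod a b (Suc n)) = comm (b n) (a n) \<otimes> inv (comm_prod a b n)"
      using that by (simp add: inv_mult_group m_assoc)
    then show ?case using Suc comm_prods_mult[OF comm_in_comm_prods[OF ab(2,1)] Suc] by simp
  qed (simp add: one_comm_prods)
  then show "x \<in> comm_prods n \<Longrightarrow> inv x \<in> comm_prods n" by (auto simp: comm_prods_def)
qed

lemma inv_conj:
  assumes "k \<in> carrier G" "x \<in> carrier G"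
  shows "inv (k \<otimes> x \<otimes> inv k) = k \<otimes> inv x \<otimes> inv k"
  using assms by (simp add: inv_mult_group m_assoc)

lemma comm_prods_conj:
  assumes "x \<in> comm_prods n" "k \<in> carrier G"
  shows "k \<otimes> x \<otimes> inv k \<in> comm_prods n"
proof -
  obtain a b where ab: "range a \<subseteq> carrier G" "range b \<subseteq> carrier G" "x = comm_prod a b n"
    using assms(1) by (rule comm_prodsE)
  let ?c = "\<lambda>y. k \<otimes> y \<otimes> inv k"
  have "?c (comm_prod a b m) = comm_prod (?c \<circ> a) (?c \<circ> b) m" for m
  proof (induction m)
    case (Suc m)
    have abm: "a m \<in> carrier G" "b m \<in> carrier G" using ab by auto
    then have "?c (comm (a m) (b m)) = comm (?c (a m)) (?c (b m))"
      using assms(2) by (simp add: conj_mult inv_conj)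
    then show ?case using Suc ab abm assms(2) by (simp add: conj_mult)
  qed (use assms in simp)
  moreover have "range (?c \<circ> a) \<subseteq> carrier G" "range (?c \<circ> b) \<subseteq> carrier G"
    using ab assms(2) by auto
  ultimately show ?thesis using ab(3) by (intro comm_prodsI[of "?c \<circ> a" "?c \<circ> b"]) simp_all
qed

lemma nat_pow_conj:
  assumes "x \<in> carrier G" "k \<in> carrier G"
  shows "(k \<otimes> x \<otimes> inv k) [^] (n::nat) = k \<otimes> x [^] n \<otimes> inv k"
proof (induction n)
  case (Suc n)
  then show ?case using assms conj_mult[of k "x [^] n" x] by simp
qed (use assms in simp)

lemma derived_eq_comm_prods: "derived G (carrier G) = (\<Union>n. comm_prods n)"
proof
  show "derived G (carrier G) \<subseteq> (\<Union>n. comm_prods n)"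
  proof
    fix x assume "x \<in> derived G (carrier G)"
    then show "x \<in> (\<Union>n. comm_prods n)" unfolding derived_def
    proof (induction rule: generate.induct)
      case one
      then show ?case using one_comm_prods by blast
    next
      case (incl h)
      then show ?case using comm_in_comm_prods by blast
    next
      case (inv h)
      then show ?case using comm_in_comm_prods comm_prods_inv by blast
    next
      case (eng h1 h2)
      then show ?case using comm_prods_mult by blast
    qed
  qed
  have "comm_prod a b n \<in> derived G (carrier G)"
    if "range a \<subseteq> carrier G" "range b \<subseteq> carrier G" for a b n
  proof (induction n)
    case 0
    then show ?case unfolding derived_def by (simp add: generate.one)
  next
    case (Suc n)
    have "a n \<in> carrier G" "b n \<in> carrier G" using that by auto
    then have "comm (a n) (b n) \<in> generate G (derived_set G (carrier G))"
      by (intro generate.incl) blast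
    then show ?case using Suc unfolding derived_def by (simp add: generate.eng)
  qed
  then show "(\<Union>n. comm_prods n) \<subseteq> derived G (carrier G)" by (auto simp: comm_prods_def)
qed

text \<open>Comparing \<open>[x, y] y x = x y\<close> shows that a single commutator has value at most \<open>3 D\<close>: the
  two products \<open>x y\<close> and \<open>y x\<close> have nearly the same value. Every further factor adds another \<open>D\<close>.\<close>

lemma quasimorphism_comm_prods:
  fixes H :: "'a \<Rightarrow> int"
  assumes "\<And>x y. x \<in> carrier G \<Longrightarrow> y \<in> carrier G \<Longrightarrow> \<bar>H (x \<otimes> y) - H x - H y\<bar> \<le> D"
    and "H \<one> = 0" and "x \<in> comm_prods n"
  shows "\<bar>H x\<bar> \<le> 4 * D * int n"
proof -
  have comm: "\<bar>H (comm x y)\<bar> \<le> 3 * D" if "x \<in> carrier G" "y \<in> carrier G" for x y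
  proof -
    have "comm x y \<otimes> (y \<otimes> x) = x \<otimes> y" using that by (simp add: m_assoc)
    then show ?thesis
      using assms(1)[of "comm x y" "y \<otimes> x"] assms(1)[of x y] assms(1)[of y x] that by simp
  qed
  have "\<bar>H (comm_prod a b m)\<bar> \<le> 4 * D * int m"
    if ab: "range a \<subseteq> carrier G" "range b \<subseteq> carrier G" for a b m
  proof (induction m)
    case (Suc m)
    have "a m \<in> carrier G" "b m \<in> carrier G" using ab by auto
    then show ?case
      using comm[of "a m" "b m"] assms(1)[of "comm_prod a b m" "comm (a m) (b m)"] Suc ab
      by (simp add: algebra_simps)
  qed (use assms(2) in simp)
  then show ?thesis using assms(3) by (auto simp: comm_prods_def)
qed

end

section \<open>Presented groups\<close>

text \<open>Membership in \<open>words V\<close> is kept as an atomic fact below, since it is the form in which the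
  rules of \<open>word_eq\<close> require it; automation would otherwise break it up into statements on single
  letters.\<close>

declare in_listsD [rule del] in_listsI [rule del]

lemma word_eq_words: "word_eq V R u w \<Longrightarrow> u \<in> words V \<and> w \<in> words V"
  by (induction rule: word_eq.induct) auto

lemma word_eq_append_left:
  assumes "word_eq V R u w" "x \<in> words V"
  shows "word_eq V R (x @ u) (x @ w)"
  using assms(1)
proof (induction rule: word_eq.induct)
  case (cancel u w a e)
  then show ?case using word_eq.cancel[of "x @ u" V w a R e] assms(2) by simp
next
  case (relator u w r)
  then show ?case using word_eq.relator[of "x @ u" V w r R] assms(2) by simp
qed (use assms(2) in \<open>auto intro: word_eq.intros\<close>)

lemma word_eq_append_right:
  assumes "word_eq V R u w" "x \<in> words V"
  shows "word_eq V R (u @ x) (w @ x)"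
  using assms(1)
proof (induction rule: word_eq.induct)
  case (cancel u w a e)
  then show ?case using word_eq.cancel[of u V "w @ x" a R e] assms(2) by simp
next
  case (relator u w r)
  then show ?case using word_eq.relator[of u V "w @ x" r R] assms(2) by simp
qed (use assms(2) in \<open>auto intro: word_eq.intros\<close>)

lemma word_eq_append:
  assumes "word_eq V R u u'" "word_eq V R w w'"
  shows "word_eq V R (u @ w) (u' @ w')"
  using word_eq_append_left word_eq_append_right word_eq_words assms word_eq.trans by metis

lemma inv_word_in_words: "w \<in> words V \<Longrightarrow> inv_word w \<in> words V"
  by (auto simp: inv_word_def flip_def lists_eq_set)

lemma word_eq_inv_word: "w \<in> words V \<Longrightarrow> word_eq V R (w @ inv_word w) []"
proof (induction w rule: rev_induct)
  case (snoc x w)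
  obtain a e where x: "x = (a, e)" by fastforce
  have "word_eq V R (w @ [(a, e), (a, \<not> e)] @ inv_word w) (w @ inv_word w)"
    using snoc.prems x by (intro word_eq.cancel) (auto simp: inv_word_in_words)
  then show ?case using snoc x word_eq.trans by fastforce
qed (auto intro: word_eq.refl)

definition word_class :: "'v set \<Rightarrow> 'v word set \<Rightarrow> 'v word \<Rightarrow> 'v word set" where
  "word_class V R w = {x. word_eq V R w x}"

lemma word_class_eq_iff:
  assumes "u \<in> words V"
  shows "word_class V R u = word_class V R w \<longleftrightarrow> word_eq V R u w"
proof
  assume "word_class V R u = word_class V R w"
  moreover have "u \<in> word_class V R u" using assms by (simp add: word_class_def word_eq.refl)
  ultimately show "word_eq V R u w" by (auto simp: word_class_def intro: word_eq.sym)
next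
  assume *: "word_eq V R u w"
  then show "word_class V R u = word_class V R w"
    unfolding word_class_def by (blast intro: word_eq.sym word_eq.trans)
qed

lemma carrier_presented_group: "carrier (presented_group V R) = word_class V R ` words V"
  by (auto simp: presented_group_def quotient_def word_class_def)

lemma one_presented_group: "\<one>\<^bsub>presented_group V R\<^esub> = word_class V R []"
  by (simp add: presented_group_def word_class_def)

lemma mult_presented_group:
  assumes "u \<in> words V" "w \<in> words V"
  shows "word_class V R u \<otimes>\<^bsub>presented_group V R\<^esub> word_class V R w = word_class V R (u @ w)"
proof -
  have "(\<exists>u'. word_eq V R u u' \<and> (\<exists>w'. word_eq V R w w' \<and> word_eq V R (u' @ w') x)) \<longleftrightarrow>
      word_eq V R (u @ w) x" for x
  proof
    assume "\<exists>u'. word_eq V R u u' \<and> (\<exists>w'. word_eq V R w w' \<and> word_eq V R (u' @ w') x)"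
    then show "word_eq V R (u @ w) x" by (blast intro: word_eq_append word_eq.trans)
  next
    assume "word_eq V R (u @ w) x"
    then show "\<exists>u'. word_eq V R u u' \<and> (\<exists>w'. word_eq V R w w' \<and> word_eq V R (u' @ w') x)"
      using assms by (blast intro: word_eq.refl)
  qed
  then show ?thesis by (simp add: presented_group_def word_class_def)
qed

lemma group_presented_group: "group (presented_group V R)"
proof (rule groupI)
  show "x \<otimes>\<^bsub>presented_group V R\<^esub> y \<in> carrier (presented_group V R)"
    if "x \<in> carrier (presented_group V R)" "y \<in> carrier (presented_group V R)" for x y
    using that by (auto simp: carrier_presented_group mult_presented_group)
  show "\<one>\<^bsub>presented_group V R\<^esub> \<in> carrier (presented_group V R)"
    by (auto simp: carrier_presented_group one_presented_group)
  show "\<exists>y\<in>carrier (presented_group V R). y \<otimes>\<^bsub>presented_group V R\<^esub> x = \<one>\<^bsub>presented_group V R\<^esub>"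
    if x: "x \<in> carrier (presented_group V R)" for x
  proof -
    obtain w where w: "w \<in> words V" "x = word_class V R w" using x by (auto simp: carrier_presented_group)
    have "word_eq V R (inv_word w @ w) []"
      using word_eq_inv_word[of "inv_word w" V R] inv_word_in_words[OF w(1)] by simp
    then have "word_class V R (inv_word w @ w) = word_class V R []"
      by (metis word_class_eq_iff word_eq_words)
    then show ?thesis
      using w inv_word_in_words[OF w(1)]
      by (auto simp: carrier_presented_group one_presented_group mult_presented_group
          intro!: bexI[of _ "word_class V R (inv_word w)"])
  qed
qed (auto simp: carrier_presented_group one_presented_group mult_presented_group)

section \<open>Right-angled Artin groups\<close>

locale artin_graph =
  fixes V :: "'v set" and E :: "'v set set" and G :: "'v word set monoid" (structure)
  assumes graph: "finite_simplicial_graph V E" and G_eq: "G = raag V E"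
begin

definition commutators :: "'v word set" where
  "commutators = {[(a, True), (b, True), (a, False), (b, False)] | a b. {a, b} \<in> E}"

definition ev :: "'v word \<Rightarrow> 'v word set" where "ev = word_class V commutators"

lemma raag_eq: "G = presented_group V commutators"
  by (simp add: G_eq raag_def commutators_def)

sublocale group G
  unfolding raag_eq by (rule group_presented_group)

lemma edge_vertices: "{a, b} \<in> E \<Longrightarrow> a \<in> V \<and> b \<in> V \<and> a \<noteq> b"
  using graph unfolding finite_simplicial_graph_def by (cases "a = b") auto

lemma carrier_eq: "carrier G = ev ` words V"
  by (simp add: raag_eq carrier_presented_group ev_def)

lemma ev_closed [simp]: "w \<in> words V \<Longrightarrow> ev w \<in> carrier G"
  by (simp add: carrier_eq)

lemma ev_Nil [simp]: "ev [] = \<one>"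
  by (simp add: raag_eq one_presented_group ev_def)

lemma ev_append: "u \<in> words V \<Longrightarrow> w \<in> words V \<Longrightarrow> ev (u @ w) = ev u \<otimes> ev w"
  by (simp add: raag_eq mult_presented_group ev_def)

lemma ev_Cons: "x \<in> V \<times> UNIV \<Longrightarrow> w \<in> words V \<Longrightarrow> ev (x # w) = ev [x] \<otimes> ev w"
  using ev_append[of "[x]" w] by simp

lemma ev_eq_iff: "u \<in> words V \<Longrightarrow> ev u = ev w \<longleftrightarrow> word_eq V commutators u w"
  by (simp add: ev_def word_class_eq_iff)

lemma ev_inv_word:
  assumes "w \<in> words V"
  shows "ev (inv_word w) = inv (ev w)"
proof -
  have "ev (w @ inv_word w) = ev []"
    using assms word_eq_inv_word inv_word_in_words by (intro iffD2[OF ev_eq_iff]) auto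
  then show ?thesis
    using assms inv_word_in_words[OF assms] inv_equality[of "ev w" "ev (inv_word w)"]
    by (metis ev_Nil ev_append ev_closed inv_inv)
qed

lemma ev_inv_letter: "a \<in> V \<Longrightarrow> ev [(a, \<not> e)] = inv ev [(a, e)]"
  using ev_inv_word[of "[(a, e)]"] by simp

lemma relators_in_words: "r \<in> commutators \<Longrightarrow> r \<in> words V"
  using edge_vertices by (auto simp: commutators_def)

lemma adjacent_commute_letters:
  assumes "{a, b} \<in> E"
  shows "ev [(a, True)] \<otimes> ev [(b, True)] = ev [(b, True)] \<otimes> ev [(a, True)]"
proof -
  have V: "a \<in> V" "b \<in> V" using edge_vertices assms by auto
  have r: "[(a, True), (b, True), (a, False), (b, False)] \<in> commutators"
    using assms by (auto simp: commutators_def)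
  have "word_eq V commutators ([] @ [(a, True), (b, True), (a, False), (b, False)] @ []) ([] @ [])"
    using r relators_in_words[OF r] by (intro word_eq.relator) auto
  then have "ev [(a, True), (b, True), (a, False), (b, False)] = ev []"
    using relators_in_words[OF r] by (intro iffD2[OF ev_eq_iff]) auto
  moreover have "ev [(a, True), (b, True), (a, False), (b, False)] =
      ev [(a, True)] \<otimes> (ev [(b, True)] \<otimes> (ev [(a, False)] \<otimes> ev [(b, False)]))"
    using V ev_Cons[of "(a, True)" "[(b, True), (a, False), (b, False)]"]
      ev_Cons[of "(b, True)" "[(a, False), (b, False)]"] ev_Cons[of "(a, False)" "[(b, False)]"]
    by simp
  ultimately have "ev [(a, True)] \<otimes> ev [(b, True)] \<otimes> inv (ev [(b, True)] \<otimes> ev [(a, True)]) = \<one>"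
    using V ev_inv_letter[of a True] ev_inv_letter[of b True] by (simp add: inv_mult_group m_assoc)
  then show ?thesis using V by (subst (asm) inv_solve_right') simp_all
qed

lemma commute_inv:
  assumes "x \<in> carrier G" "y \<in> carrier G" "x \<otimes> y = y \<otimes> x"
  shows "inv x \<otimes> y = y \<otimes> inv x"
  using assms by (metis inv_closed inv_solve_left inv_solve_right m_assoc m_closed)

lemma adjacent_commute:
  assumes "{a, b} \<in> E"
  shows "ev [(a, e)] \<otimes> ev [(b, f)] = ev [(b, f)] \<otimes> ev [(a, e)]"
proof -
  have V: "a \<in> V" "b \<in> V" using edge_vertices assms by auto
  have 1: "ev [(a, e)] \<otimes> ev [(b, True)] = ev [(b, True)] \<otimes> ev [(a, e)]" for e
    using adjacent_commute_letters[OF assms] commute_inv[of "ev [(a, True)]" "ev [(b, True)]"]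
      ev_inv_letter[of a True] V by (cases e) auto
  then show ?thesis
    using commute_inv[of "ev [(b, True)]" "ev [(a, e)]"] ev_inv_letter[of b True] V by (cases f) auto
qed

subsection \<open>Parabolic subgroups\<close>

definition parabolic :: "'v set \<Rightarrow> 'v word set set" where
  "parabolic S = ev ` words S"

definition keep :: "'v set \<Rightarrow> 'v word \<Rightarrow> 'v word" where
  "keep S w = filter (\<lambda>x. fst x \<in> S) w"

lemma keep_simps [simp]: "keep S [] = []" "keep S (u @ w) = keep S u @ keep S w"
    "keep S (x # w) = (if fst x \<in> S then x # keep S w else keep S w)"
  by (auto simp: keep_def)

lemma keep_words: "w \<in> words V \<Longrightarrow> keep S w \<in> words V" "w \<in> words V \<Longrightarrow> keep S w \<in> words S"
  by (auto simp: keep_def lists_eq_set)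

lemma words_mono: "S \<subseteq> V \<Longrightarrow> w \<in> words S \<Longrightarrow> w \<in> words V"
  by (auto simp: lists_eq_set)

lemma keep_id: "w \<in> words S \<Longrightarrow> keep S w = w"
  by (induction w) auto

text \<open>Deleting all letters outside \<open>S\<close> maps a relator to itself, to a cancelling pair or to the
  empty word, so it induces a retraction of the group onto the subgroup generated by \<open>S\<close>.\<close>

lemma word_eq_keep:
  "word_eq V commutators u w \<Longrightarrow> word_eq V commutators (keep S u) (keep S w)"
proof (induction rule: word_eq.induct)
  case (cancel u w a e)
  then show ?case
    using word_eq.cancel[of "keep S u" V "keep S w" a] by (auto simp: keep_words intro: word_eq.refl)
next
  case (relator u w r)
  then obtain a b where r: "r = [(a, True), (b, True), (a, False), (b, False)]" "{a, b} \<in> E"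
    by (auto simp: commutators_def)
  have "word_eq V commutators (keep S u @ keep S r @ keep S w) (keep S u @ keep S w)"
  proof (cases "a \<in> S \<and> b \<in> S")
    case True
    then have "keep S r = r" using r by simp
    then show ?thesis using relator by (auto simp: keep_words intro: word_eq.relator)
  next
    case False
    have "a \<in> V" "b \<in> V" using edge_vertices[OF r(2)] by auto
    with False r(1) consider "keep S r = []" | c where "c \<in> V" "keep S r = [(c, True), (c, False)]"
      by (cases "a \<in> S"; cases "b \<in> S") auto
    then show ?thesis
    proof cases
      case 1
      then show ?thesis using relator by (auto simp: keep_words intro: word_eq.refl)
    next
      case 2
      then show ?thesis
        using word_eq.cancel[of "keep S u" V "keep S w" c commutators True] relator
        by (auto simp: keep_words)
    qed
  qed
  then show ?case by simp
qed (auto simp: keep_words intro: word_eq.intros)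

lemma ev_keep: "u \<in> words V \<Longrightarrow> ev u = ev w \<Longrightarrow> ev (keep S u) = ev (keep S w)"
  by (metis ev_eq_iff keep_words(1) word_eq_keep)

lemma ev_keep_parabolic:
  assumes "S \<subseteq> V" "w \<in> words V" "ev w \<in> parabolic S"
  shows "ev (keep S w) = ev w"
proof -
  obtain u where u: "u \<in> words S" "ev w = ev u" using assms(3) by (auto simp: parabolic_def)
  then show ?thesis using ev_keep[OF assms(2), of u S] keep_id[of u S] by simp
qed

lemma subgroup_parabolic:
  assumes "S \<subseteq> V"
  shows "subgroup (parabolic S) G"
proof
  show "parabolic S \<subseteq> carrier G" using assms words_mono by (auto simp: parabolic_def)
  show "\<one> \<in> parabolic S" by (force simp: parabolic_def image_iff)
  show "x \<otimes> y \<in> parabolic S" if xy: "x \<in> parabolic S" "y \<in> parabolic S" for x y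
  proof -
    obtain u w where "u \<in> words S" "w \<in> words S" "x = ev u" "y = ev w"
      using xy by (auto simp: parabolic_def)
    then show ?thesis using words_mono[OF assms] unfolding parabolic_def
      by (intro image_eqI[of _ _ "u @ w"]) (simp_all add: ev_append)
  qed
  show "inv x \<in> parabolic S" if x: "x \<in> parabolic S" for x
  proof -
    obtain u where u: "u \<in> words S" "x = ev u" using x by (auto simp: parabolic_def)
    then show ?thesis using words_mono[OF assms] inv_word_in_words[of u S] unfolding parabolic_def
      by (intro image_eqI[of _ _ "inv_word u"]) (simp_all add: ev_inv_word)
  qed
qed

definition geodesic :: "'v word \<Rightarrow> bool" where
  "geodesic w \<longleftrightarrow> w \<in> words V \<and> (\<forall>u\<in>words V. ev u = ev w \<longrightarrow> length w \<le> length u)"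

lemma geodesicD: "geodesic w \<Longrightarrow> w \<in> words V"
  "geodesic w \<Longrightarrow> u \<in> words V \<Longrightarrow> ev u = ev w \<Longrightarrow> length w \<le> length u"
  by (auto simp: geodesic_def)

lemma geodesic_exists:
  assumes "u \<in> words V"
  obtains w where "geodesic w" "ev w = ev u" "length w \<le> length u"
proof -
  let ?P = "\<lambda>w. w \<in> words V \<and> ev w = ev u"
  obtain w where w: "?P w" "\<forall>x. ?P x \<longrightarrow> length w \<le> length x"
    using ex_has_least_nat[of ?P u length] assms by auto
  then show thesis using that[of w] assms unfolding geodesic_def by auto
qed

text \<open>The subgroup \<open>L v\<close> generated by the link of \<open>v\<close> commutes with \<open>v\<close>; it is the edge stabiliser
  of the tree of the HNN extension with stable letter \<open>v\<close>.\<close>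

definition link :: "'v \<Rightarrow> 'v set" where "link v = {b. {v, b} \<in> E}"

lemma link_subset: "link v \<subseteq> V" and not_in_link: "v \<notin> link v"
  using edge_vertices[of v] edge_vertices[of v v] by (auto simp: link_def)

abbreviation L :: "'v \<Rightarrow> 'v word set set" where "L v \<equiv> parabolic (link v)"

lemma L_subgroup: "subgroup (L v) G"
  by (rule subgroup_parabolic[OF link_subset])

lemma L_carrier: "x \<in> L v \<Longrightarrow> x \<in> carrier G"
  using subgroup.subset[OF L_subgroup] by blast

lemma L_commute:
  assumes "v \<in> V" "x \<in> L v"
  shows "ev [(v, e)] \<otimes> x = x \<otimes> ev [(v, e)]"
proof -
  have "ev [(v, e)] \<otimes> ev u = ev u \<otimes> ev [(v, e)]" if "u \<in> words (link v)" for u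
    using that
  proof (induction u)
    case (Cons y u)
    obtain b f where y: "y = (b, f)" by fastforce
    have V: "b \<in> V" "u \<in> words V" and E: "{v, b} \<in> E"
      using Cons.hyps y words_mono[OF link_subset] edge_vertices by (auto simp: link_def)
    have 1: "ev [(v, e)] \<otimes> ev [y] = ev [y] \<otimes> ev [(v, e)]" using adjacent_commute[OF E] y by simp
    have c: "ev [(v, e)] \<in> carrier G" "ev [y] \<in> carrier G" "ev u \<in> carrier G"
      using V y assms(1) by auto
    have "ev [(v, e)] \<otimes> (ev [y] \<otimes> ev u) = ev [y] \<otimes> (ev [(v, e)] \<otimes> ev u)"
      using 1 c by (metis m_assoc)
    also have "\<dots> = (ev [y] \<otimes> ev u) \<otimes> ev [(v, e)]"
      using Cons.IH c by (simp add: m_assoc)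
    finally show ?case using V ev_Cons[of y u] y by simp
  qed (use assms(1) in simp)
  then show ?thesis using assms(2) by (auto simp: parabolic_def)
qed

end

section \<open>Translating paths of cosets\<close>

context group begin

abbreviation coset_action :: "'a \<Rightarrow> 'a set \<Rightarrow> 'a set" (infixl "\<star>" 60) where
  "k \<star> A \<equiv> l_coset G k A"

lemma l_coset_eq_iff:
  assumes "subgroup H G" "x \<in> carrier G" "y \<in> carrier G"
  shows "x \<star> H = y \<star> H \<longleftrightarrow> inv y \<otimes> x \<in> H"
proof
  assume *: "x \<star> H = y \<star> H"
  have "x \<otimes> \<one> \<in> x \<star> H"
    unfolding l_coset_def using subgroup.one_closed[OF assms(1)] by blast
  then obtain h where "h \<in> H" "x = y \<otimes> h" using * assms unfolding l_coset_def by auto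
  then show "inv y \<otimes> x \<in> H"
    using assms subgroup.mem_carrier[OF assms(1)] by simp
next
  assume *: "inv y \<otimes> x \<in> H"
  have "x \<in> y \<star> H"
    unfolding l_coset_def using * assms by (auto intro!: bexI[of _ "inv y \<otimes> x"])
  then show "x \<star> H = y \<star> H" using l_repr_independence[of x y H] assms by simp
qed

lemma translate_eq_iff:
  assumes "subgroup H G" "k \<in> carrier G" "x \<in> carrier G" "y \<in> carrier G"
  shows "k \<star> (x \<star> H) = y \<star> H \<longleftrightarrow> inv y \<otimes> k \<otimes> x \<in> H"
proof -
  have "k \<star> (x \<star> H) = (k \<otimes> x) \<star> H"
    using assms subgroup.subset[OF assms(1)] by (simp add: lcos_m_assoc)
  then show ?thesis using assms by (simp add: l_coset_eq_iff m_assoc)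
qed

lemma l_coset_inj:
  assumes "k \<in> carrier G"
  shows "inj_on (l_coset G k) (Pow (carrier G))"
proof (rule inj_onI)
  fix A B assume *: "A \<in> Pow (carrier G)" "B \<in> Pow (carrier G)" "k \<star> A = k \<star> B"
  have "inv k \<star> (k \<star> C) = C" if "C \<subseteq> carrier G" for C
    using that assms by (simp add: lcos_m_assoc lcos_mult_one)
  then show "A = B" using * by (metis PowD)
qed

definition translate :: "'a \<Rightarrow> ('a set \<times> bool) list \<Rightarrow> ('a set \<times> bool) list" where
  "translate k p = map (apfst (l_coset G k)) p"

text \<open>Translation is a well-behaved action only on subsets of the carrier.\<close>

definition carrier_path :: "('a set \<times> bool) list \<Rightarrow> bool" where
  "carrier_path p \<longleftrightarrow> fst ` set p \<subseteq> Pow (carrier G)"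

lemma translate_simps [simp]: "translate k [] = []" "translate k (p @ q) = translate k p @ translate k q"
    "translate k (x # p) = (k \<star> fst x, snd x) # translate k p" "length (translate k p) = length p"
    "translate k p = [] \<longleftrightarrow> p = []"
  by (auto simp: translate_def prod_eq_iff)

lemma translate_nth [simp]: "i < length p \<Longrightarrow> translate k p ! i = (k \<star> fst (p ! i), snd (p ! i))"
  by (simp add: translate_def prod_eq_iff)

lemma translate_inv_word: "translate k (inv_word p) = inv_word (translate k p)"
  by (induction p) (auto simp: flip_def)

lemma carrier_path_simps [simp]: "carrier_path []" "carrier_path (p @ q) \<longleftrightarrow> carrier_path p \<and> carrier_path q"
    "carrier_path (x # p) \<longleftrightarrow> fst x \<subseteq> carrier G \<and> carrier_path p"
  by (auto simp: carrier_path_def)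

lemma carrier_path_nth: "carrier_path p \<Longrightarrow> i < length p \<Longrightarrow> fst (p ! i) \<subseteq> carrier G"
  unfolding carrier_path_def by (metis PowD image_subset_iff nth_mem)

lemma translate_translate:
  "carrier_path p \<Longrightarrow> j \<in> carrier G \<Longrightarrow> k \<in> carrier G \<Longrightarrow> translate j (translate k p) = translate (j \<otimes> k) p"
  by (induction p) (auto simp: lcos_m_assoc)

lemma translate_one: "carrier_path p \<Longrightarrow> translate \<one> p = p"
  by (induction p) (auto simp: lcos_mult_one)

lemma carrier_path_inv_word: "carrier_path p \<Longrightarrow> carrier_path (inv_word p)"
  by (induction p) auto

lemma nf_translate:
  assumes "carrier_path p" "k \<in> carrier G"
  shows "nf (translate k p) = translate k (nf p)" "carrier_path (nf p)"
  using nf_map[of "l_coset G k" "Pow (carrier G)" p] l_coset_inj[OF assms(2)] assms(1)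
  by (auto simp: carrier_path_def translate_def)

lemma reduced_translate:
  assumes "carrier_path p" "k \<in> carrier G" "reduced p"
  shows "reduced (translate k p)"
  using nf_translate(1)[OF assms(1,2)] nf_reduced[OF assms(3)] by (metis reduced_nf)

definition orbit :: "('a set \<times> bool) list \<Rightarrow> ('a set \<times> bool) list set" where
  "orbit p = (\<lambda>k. translate k p) ` carrier G"

lemma inv_word_orbit: "inv_word ` orbit p = orbit (inv_word p)"
  by (simp add: orbit_def image_image translate_inv_word)

lemma packs_mono: "packs Q w n \<Longrightarrow> Q \<subseteq> R \<Longrightarrow> packs R w n"
  by (induction n arbitrary: w) (auto, blast)

lemma packs_translate:
  assumes "carrier_path p" "k \<in> carrier G" "packs (orbit p) w n"
  shows "packs (orbit p) (translate k w) n"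
proof -
  have "translate k ` orbit p \<subseteq> orbit p"
    using assms by (auto simp: orbit_def translate_translate)
  then show ?thesis using packs_image[OF assms(3), of "translate k"] packs_mono by fastforce
qed

lemma packing_number_translate:
  assumes "carrier_path p" "k \<in> carrier G" "carrier_path w"
  shows "packing_number (orbit p) (translate k w) = packing_number (orbit p) w"
proof -
  have "translate (inv k) (translate k w) = w"
    using assms by (simp add: translate_translate translate_one)
  then have "packs (orbit p) (translate k w) n = packs (orbit p) w n" for n
    using packs_translate[of p k w n] packs_translate[of p "inv k" "translate k w" n] assms by auto
  then show ?thesis by (simp add: packing_number_def)
qed

lemma tally_translate:
  assumes "carrier_path p" "k \<in> carrier G" "carrier_path w"
  shows "tally (orbit p) (translate k w) = tally (orbit p) w"
  using assms by (simp add: tally_def inv_word_orbit packing_number_translate carrier_path_inv_word)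

end

section \<open>The path of hyperplanes crossed by a word\<close>

context artin_graph begin

text \<open>The coset of \<open>L v\<close> that corresponds to the edge crossed when a word, having reached \<open>g\<close>,
  continues with \<open>v\<close> (\<open>e = True\<close>) or \<open>v\<^sup>-\<^sup>1\<close>. An edge is named after the endpoint from which it is
  crossed in positive direction, so the inverse letter first moves to the other endpoint.\<close>

definition hyperplane :: "'v \<Rightarrow> 'v word set \<Rightarrow> bool \<Rightarrow> 'v word set set" where
  "hyperplane v g e = (if e then g else g \<otimes> ev [(v, False)]) \<star> L v"

fun crossings :: "'v \<Rightarrow> 'v word set \<Rightarrow> 'v word \<Rightarrow> ('v word set set \<times> bool) list" where
  "crossings v g [] = []"
| "crossings v g (x # w) =
     (if fst x = v then [(hyperplane v g (snd x), snd x)] else []) @ crossings v (g \<otimes> ev [x]) w"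

lemma crossings_append:
  assumes "g \<in> carrier G" "u \<in> words V" "w \<in> words V"
  shows "crossings v g (u @ w) = crossings v g u @ crossings v (g \<otimes> ev u) w"
  using assms(1,2)
proof (induction u arbitrary: g)
  case (Cons x u)
  then have "g \<otimes> ev [x] \<otimes> ev u = g \<otimes> ev (x # u)" by (simp add: m_assoc ev_Cons[of x u])
  then show ?case using Cons by simp
qed simp

lemma hyperplane_translate:
  assumes "g \<in> carrier G" "k \<in> carrier G" "v \<in> V"
  shows "hyperplane v (k \<otimes> g) e = k \<star> hyperplane v g e"
  using assms subgroup.subset[OF L_subgroup] by (simp add: hyperplane_def lcos_m_assoc m_assoc)

lemma hyperplane_subset: "g \<in> carrier G \<Longrightarrow> v \<in> V \<Longrightarrow> hyperplane v g e \<subseteq> carrier G"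
  using L_carrier[of _ v] by (auto simp: hyperplane_def l_coset_def)

lemma crossings_translate:
  assumes "g \<in> carrier G" "k \<in> carrier G" "v \<in> V" "w \<in> words V"
  shows "crossings v (k \<otimes> g) w = translate k (crossings v g w)"
  using assms(1,4)
proof (induction w arbitrary: g)
  case (Cons x w)
  then have "k \<otimes> g \<otimes> ev [x] = k \<otimes> (g \<otimes> ev [x])" using assms(2) by (simp add: m_assoc)
  then show ?case using Cons assms by (simp add: hyperplane_translate)
qed simp

lemma carrier_path_crossings: "g \<in> carrier G \<Longrightarrow> v \<in> V \<Longrightarrow> w \<in> words V \<Longrightarrow> carrier_path (crossings v g w)"
  by (induction w arbitrary: g) (auto simp: hyperplane_subset)

lemma crossings_eq_Nil: "crossings v g w = [] \<longleftrightarrow> v \<notin> fst ` set w"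
  by (induction w arbitrary: g) auto

lemma crossings_split:
  assumes "crossings v g w = P @ x # Q" "g \<in> carrier G" "w \<in> words V"
  shows "\<exists>p q. w = p @ (v, snd x) # q \<and> crossings v g p = P \<and>
      fst x = hyperplane v (g \<otimes> ev p) (snd x) \<and>
      crossings v (g \<otimes> ev (p @ [(v, snd x)])) q = Q"
  using assms
proof (induction w arbitrary: g P)
  case (Cons y w)
  have c: "g \<otimes> ev [y] \<in> carrier G" "w \<in> words V" "y \<in> V \<times> UNIV" using Cons.prems by auto
  show ?case
  proof (cases "fst y = v \<and> P = []")
    case True
    then have x: "x = (hyperplane v g (snd y), snd y)" "crossings v (g \<otimes> ev [y]) w = Q"
      using Cons.prems(1) by auto
    then show ?thesis using True Cons.prems(2)
      by (intro exI[of _ "[]"] exI[of _ w]) (cases y, auto)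
  next
    case False
    define P' where "P' = (if fst y = v then tl P else P)"
    have P: "P = (if fst y = v then [(hyperplane v g (snd y), snd y)] else []) @ P'"
      and "crossings v (g \<otimes> ev [y]) w = P' @ x # Q"
      using Cons.prems(1) False unfolding P'_def by (cases P; auto)+
    from Cons.IH[OF this(2) c(1,2)] obtain p q where pq: "w = p @ (v, snd x) # q"
      "crossings v (g \<otimes> ev [y]) p = P'"
      "fst x = hyperplane v (g \<otimes> ev [y] \<otimes> ev p) (snd x)"
      "crossings v (g \<otimes> ev [y] \<otimes> ev (p @ [(v, snd x)])) q = Q" by blast
    have "p \<in> words V" "p @ [(v, snd x)] \<in> words V" using c(2) pq(1) by auto
    then have "g \<otimes> ev [y] \<otimes> ev p = g \<otimes> ev (y # p)"
      "g \<otimes> ev [y] \<otimes> ev (p @ [(v, snd x)]) = g \<otimes> ev ((y # p) @ [(v, snd x)])"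
      using c(3) Cons.prems(2) ev_Cons[of y p] ev_Cons[of y "p @ [(v, snd x)]"] by (simp_all add: m_assoc)
    then show ?thesis using pq P by (intro exI[of _ "y # p"] exI[of _ q]) auto
  qed
qed simp

text \<open>After a crossing with sign \<open>s\<close>, which ends at \<open>b\<close>, and a stretch \<open>u\<close>, consider a second
  crossing with the opposite sign. Relative to the position \<open>b\<close>, the element \<open>k\<close> becomes
  \<open>z = b\<^sup>-\<^sup>1 k b\<close>, and it carries one of the two edges to the other exactly if \<open>z \<in> u L v\<close>,
  respectively \<open>z u \<in> L v\<close>. Both signs give the same condition because \<open>v\<close> commutes with \<open>L v\<close>.\<close>

lemma hyperplane_turn:
  fixes s :: bool
  assumes "v \<in> V" "a \<in> carrier G" "u \<in> carrier G" "k \<in> carrier G"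
  defines "b \<equiv> a \<otimes> ev [(v, s)]"
  shows "k \<star> hyperplane v a s = hyperplane v (b \<otimes> u) (\<not> s) \<longleftrightarrow>
      inv u \<otimes> (inv b \<otimes> k \<otimes> b) \<in> L v"
    and "k \<star> hyperplane v (b \<otimes> u) (\<not> s) = hyperplane v a s \<longleftrightarrow>
      inv b \<otimes> k \<otimes> b \<otimes> u \<in> L v"
proof -
  define c where "c = (if s then ev [(v, False)] else \<one>)"
  have c: "c \<in> carrier G" using assms by (simp add: c_def)
  have b: "b \<in> carrier G" using assms by (simp add: b_def)
  have inv: "ev [(v, True)] \<otimes> ev [(v, False)] = \<one>" "ev [(v, False)] \<otimes> ev [(v, True)] = \<one>"
    using ev_inv_letter[of v True] assms(1) by simp_all
  have "a = b \<otimes> c" if s using that inv assms(1,2) by (simp add: b_def c_def m_assoc)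
  moreover have "a \<otimes> ev [(v, False)] = b" if "\<not> s" using that by (simp add: b_def)
  ultimately have h: "hyperplane v a s = b \<otimes> c \<star> L v" "hyperplane v (b \<otimes> u) (\<not> s) = b \<otimes> u \<otimes> c \<star> L v"
    using assms(1-4) b by (auto simp: hyperplane_def c_def)
  have conj: "inv c \<otimes> y \<otimes> c \<in> L v \<longleftrightarrow> y \<in> L v" if y: "y \<in> carrier G" for y
  proof -
    have comm: "c \<otimes> z = z \<otimes> c" if "z \<in> L v" for z
      using that L_commute[OF assms(1) that] L_carrier by (auto simp: c_def)
    show ?thesis
    proof
      assume z: "inv c \<otimes> y \<otimes> c \<in> L v"
      have "c \<otimes> (inv c \<otimes> y \<otimes> c) = y \<otimes> c" using c y by (simp add: m_assoc)
      then have "(inv c \<otimes> y \<otimes> c) \<otimes> c = y \<otimes> c" using comm[OF z] by simp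
      then have "inv c \<otimes> y \<otimes> c = y" using c y by simp
      then show "y \<in> L v" using z by simp
    next
      assume z: "y \<in> L v"
      have "inv c \<otimes> y \<otimes> c = inv c \<otimes> (c \<otimes> y)" using comm[OF z] c y by (simp add: m_assoc)
      then show "inv c \<otimes> y \<otimes> c \<in> L v" using z c y by simp
    qed
  qed
  show "k \<star> hyperplane v a s = hyperplane v (b \<otimes> u) (\<not> s) \<longleftrightarrow> inv u \<otimes> (inv b \<otimes> k \<otimes> b) \<in> L v"
    using conj[of "inv u \<otimes> (inv b \<otimes> k \<otimes> b)"] b c assms(1-4) unfolding h
    by (simp add: translate_eq_iff[OF L_subgroup] inv_mult_group m_assoc)
  show "k \<star> hyperplane v (b \<otimes> u) (\<not> s) = hyperplane v a s \<longleftrightarrow> inv b \<otimes> k \<otimes> b \<otimes> u \<in> L v"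
    using conj[of "inv b \<otimes> k \<otimes> b \<otimes> u"] b c assms(1-4) unfolding h
    by (simp add: translate_eq_iff[OF L_subgroup] inv_mult_group m_assoc)
qed

text \<open>The form in which \<open>hyperplane_turn\<close> is used: two neighbouring entries of opposite sign in the
  path of a word come from a factor \<open>v\<^sup>s u v\<^sup>-\<^sup>s\<close> of that word.\<close>

lemma adjacent_crossings:
  assumes "v \<in> V" "w \<in> words V" "crossings v \<one> w = P @ x # y # Q" "snd y \<noteq> snd x"
  obtains p u q where "w = p @ (v, snd x) # u @ (v, snd y) # q" "v \<notin> fst ` set u"
    "\<And>k. k \<in> carrier G \<Longrightarrow> k \<star> fst x = fst y \<longleftrightarrow>
      inv (ev u) \<otimes> (inv (ev (p @ [(v, snd x)])) \<otimes> k \<otimes> ev (p @ [(v, snd x)])) \<in> L v"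
    "\<And>k. k \<in> carrier G \<Longrightarrow> k \<star> fst y = fst x \<longleftrightarrow>
      inv (ev (p @ [(v, snd x)])) \<otimes> k \<otimes> ev (p @ [(v, snd x)]) \<otimes> ev u \<in> L v"
proof -
  obtain p r where pr: "w = p @ (v, snd x) # r" "fst x = hyperplane v (\<one> \<otimes> ev p) (snd x)"
    "crossings v (\<one> \<otimes> ev (p @ [(v, snd x)])) r = y # Q"
    using crossings_split[of v \<one> w P x "y # Q"] assms by auto
  have V: "p \<in> words V" "r \<in> words V" using assms(2) pr(1) by auto
  define b where "b = ev (p @ [(v, snd x)])"
  have b: "b = ev p \<otimes> ev [(v, snd x)]" "b \<in> carrier G"
    unfolding b_def using V assms(1) by (simp_all add: ev_append)
  obtain u q where uq: "r = u @ (v, snd y) # q" "crossings v b u = []"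
    "fst y = hyperplane v (b \<otimes> ev u) (snd y)"
    using crossings_split[of v b r "[]" y Q] pr(3) V b b_def by auto
  have u: "u \<in> words V" "v \<notin> fst ` set u" using uq V crossings_eq_Nil by auto
  have y: "snd y = (\<not> snd x)" using assms(4) by auto
  have x: "fst x = hyperplane v (ev p) (snd x)" using pr(2) V by simp
  show thesis
  proof (rule that[of p u q])
    fix k assume k: "k \<in> carrier G"
    note * = hyperplane_turn[of v "ev p" "ev u" k "snd x", OF assms(1) _ _ k, folded b(1)]
    show "k \<star> fst x = fst y \<longleftrightarrow>
      inv (ev u) \<otimes> (inv (ev (p @ [(v, snd x)])) \<otimes> k \<otimes> ev (p @ [(v, snd x)])) \<in> L v"
      unfolding b_def[symmetric] uq(3) x y using V u by (intro *(1)) auto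
    show "k \<star> fst y = fst x \<longleftrightarrow>
      inv (ev (p @ [(v, snd x)])) \<otimes> k \<otimes> ev (p @ [(v, snd x)]) \<otimes> ev u \<in> L v"
      unfolding b_def[symmetric] uq(3) x y using V u by (intro *(2)) auto
  qed (use pr uq u in auto)
qed

text \<open>Otherwise \<open>v\<^sup>s u v\<^sup>-\<^sup>s\<close> could be replaced by the shorter \<open>u\<close>.\<close>

lemma geodesic_turn:
  assumes "geodesic (p @ (v, s) # u @ (v, \<not> s) # q)"
  shows "ev u \<notin> L v"
proof
  assume u: "ev u \<in> L v"
  have V: "v \<in> V" "p \<in> words V" "u \<in> words V" "q \<in> words V" using geodesicD(1)[OF assms] by auto
  have "ev ((v, s) # u @ (v, \<not> s) # q) = ev [(v, s)] \<otimes> (ev u \<otimes> (ev [(v, \<not> s)] \<otimes> ev q))"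
    using V ev_Cons[of "(v, s)" "u @ (v, \<not> s) # q"] ev_append[of u "(v, \<not> s) # q"]
      ev_Cons[of "(v, \<not> s)" q] by simp
  also have "\<dots> = (ev u \<otimes> ev [(v, s)]) \<otimes> (inv (ev [(v, s)]) \<otimes> ev q)"
    using V L_commute[OF V(1) u] ev_inv_letter[of v s] by (simp flip: m_assoc)
  also have "\<dots> = ev (u @ q)"
    using V by (simp add: m_assoc ev_append)
  finally have "ev (p @ (v, s) # u @ (v, \<not> s) # q) = ev (p @ u @ q)"
    using V by (simp add: ev_append)
  then have "length (p @ (v, s) # u @ (v, \<not> s) # q) \<le> length (p @ u @ q)"
    using geodesicD(2)[OF assms, of "p @ u @ q"] V by auto
  then show False by simp
qed

lemma reduced_crossings:
  assumes "geodesic w" "v \<in> V"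
  shows "reduced (crossings v \<one> w)"
proof (rule successivelyI)
  fix P x y Q assume *: "crossings v \<one> w = P @ x # y # Q"
  have w: "w \<in> words V" using assms geodesicD by blast
  show "y \<noteq> flip x"
  proof
    assume y: "y = flip x"
    then have "snd y \<noteq> snd x" by simp
    from adjacent_crossings[OF assms(2) w * this] obtain p u q where
      pq: "w = p @ (v, snd x) # u @ (v, snd y) # q" and
      k: "\<And>k. k \<in> carrier G \<Longrightarrow> k \<star> fst x = fst y \<longleftrightarrow>
        inv (ev u) \<otimes> (inv (ev (p @ [(v, snd x)])) \<otimes> k \<otimes> ev (p @ [(v, snd x)])) \<in> L v" by metis
    have "fst x \<subseteq> carrier G"
      using carrier_path_crossings[OF one_closed assms(2) w] * by simp
    then have "\<one> \<star> fst x = fst y" using y by (simp add: lcos_mult_one)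
    moreover have "p \<in> words V" "u \<in> words V" using pq w by auto
    ultimately have "inv (ev u) \<in> L v" using k[of \<one>] assms(2) by simp
    then have "inv (inv (ev u)) \<in> L v" by (rule subgroup.m_inv_closed[OF L_subgroup])
    then have "ev u \<in> L v" using \<open>u \<in> words V\<close> by simp
    then show False using geodesic_turn assms(1) pq y by auto
  qed
qed

text \<open>The path of a product follows the first path and then the second one, translated to the endpoint
  of the first; so paths behave like a crossed homomorphism.\<close>

lemma nf_crossings_append:
  assumes "u \<in> words V" "w \<in> words V" "v \<in> V"
  shows "nf (crossings v \<one> (u @ w)) = nf (nf (crossings v \<one> u) @ translate (ev u) (nf (crossings v \<one> w)))"
proof -
  have "crossings v \<one> (u @ w) = crossings v \<one> u @ translate (ev u) (crossings v \<one> w)"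
    using assms crossings_append[of \<one> u w v] crossings_translate[of \<one> "ev u" v w] by simp
  then show ?thesis
    using nf_translate(1)[OF carrier_path_crossings[of \<one> v w], of "ev u"] assms
    by (simp flip: nf_nf_append[of "crossings v \<one> u"])
qed

lemma crossings_delete:
  assumes "u \<in> words V" "m \<in> words V" "w \<in> words V" "v \<in> V"
    and "ev m = \<one>" "nf (crossings v (ev u) m) = []"
  shows "nf (crossings v \<one> (u @ m @ w)) = nf (crossings v \<one> (u @ w))"
proof -
  have "crossings v \<one> (u @ m @ w) = crossings v \<one> u @ crossings v (ev u) m @ crossings v (ev u) w"
    using assms crossings_append[of \<one> u "m @ w" v] crossings_append[of "ev u" m w v] by simp
  moreover have "nf (crossings v (ev u) m @ crossings v (ev u) w) = nf (crossings v (ev u) w)"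
    using nf_cong_append[of "crossings v (ev u) m" "[]"] assms(6) by fastforce
  ultimately show ?thesis
    using assms crossings_append[of \<one> u w v] by (simp add: nf_append)
qed

lemma crossings_cancel_pair:
  assumes "g \<in> carrier G" "v \<in> V" "a \<in> V"
  shows "nf (crossings v g [(a, e), (a, \<not> e)]) = []"
proof -
  have "g \<otimes> ev [(a, True)] \<otimes> ev [(a, False)] = g"
    using assms ev_inv_letter[of a True] by (simp add: m_assoc)
  then show ?thesis using assms by (cases e) (auto simp: hyperplane_def nf_def)
qed

lemma crossings_relator:
  assumes "g \<in> carrier G" "v \<in> V" "{a, b} \<in> E"
  shows "nf (crossings v g [(a, True), (b, True), (a, False), (b, False)]) = []"
proof -
  have V: "a \<in> V" "b \<in> V" "a \<noteq> b" using edge_vertices[OF assms(3)] by auto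
  have L: "g \<otimes> ev [(c, True)] \<star> L v = g \<star> L v" if "c \<in> link v" for c
  proof -
    have "ev [(c, True)] \<in> L v" "c \<in> V" using that link_subset[of v] by (auto simp: parabolic_def)
    then show ?thesis using assms(1) by (simp add: l_coset_eq_iff[OF L_subgroup])
  qed
  show ?thesis
  proof (cases "a = v \<or> b = v")
    case True
    then show ?thesis
    proof
      assume a: "a = v"
      then have "b \<in> link v" using assms(3) by (simp add: link_def)
      moreover have "g \<otimes> ev [(v, True)] \<otimes> ev [(b, True)] \<otimes> ev [(v, False)] = g \<otimes> ev [(b, True)]"
        using assms V adjacent_commute[of v b True True] ev_inv_letter[of v True] a
        by (simp add: m_assoc adjacent_commute[of v b False True])
      ultimately show ?thesis using a V L by (simp add: hyperplane_def nf_def)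
    next
      assume b: "b = v"
      then have "a \<in> link v" using assms(3) by (simp add: link_def insert_commute)
      moreover have "g \<otimes> ev [(a, True)] \<otimes> ev [(v, True)] \<otimes> ev [(a, False)] \<otimes> ev [(v, False)] = g"
        using assms V adjacent_commute[of a v True True] ev_inv_letter[of v True] ev_inv_letter[of a True] b
        by (simp add: m_assoc)
      ultimately show ?thesis using b V L by (simp add: hyperplane_def nf_def)
    qed
  qed (auto simp: nf_def)
qed

text \<open>A relator changes the path only by cancelling pairs. If it involves \<open>v\<close> and a neighbour \<open>b\<close>, the
  edge is crossed once in each direction, since \<open>b\<close> fixes the edge.\<close>

lemma word_eq_crossings:
  assumes "word_eq V commutators u w" "v \<in> V"
  shows "nf (crossings v \<one> u) = nf (crossings v \<one> w)"
  using assms(1)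
proof (induction rule: word_eq.induct)
  case (cancel u w a e)
  have "word_eq V commutators ([] @ [(a, e), (a, \<not> e)] @ []) ([] @ [])"
    using cancel by (intro word_eq.cancel) auto
  then have "ev [(a, e), (a, \<not> e)] = ev []" using cancel by (intro iffD2[OF ev_eq_iff]) auto
  then show ?case
    using cancel assms(2) crossings_cancel_pair[of "ev u" v a e] by (intro crossings_delete) auto
next
  case (relator u w r)
  obtain a b where r: "r = [(a, True), (b, True), (a, False), (b, False)]" "{a, b} \<in> E"
    using relator by (auto simp: commutators_def)
  have "word_eq V commutators ([] @ r @ []) ([] @ [])"
    using relator by (intro word_eq.relator) auto
  then have "ev r = ev []" using relator by (intro iffD2[OF ev_eq_iff]) auto
  then show ?case
    using relator assms(2) crossings_relator[of "ev u" v a b] r by (intro crossings_delete) auto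
qed auto

section \<open>Square roots in parabolic subgroups\<close>

text \<open>Induction on the length of a geodesic word \<open>w\<close> for \<open>k\<close>, for all \<open>S\<close> at once. If \<open>w\<close> contains a
  letter \<open>v \<notin> S\<close>, then \<open>k\<^sup>2 \<in> parabolic S\<close> has trivial path, so \<open>k\<close> reverses the path of \<open>w\<close>. The
  signs exclude a middle edge, hence \<open>k\<close> interchanges the two middle edges, and some conjugate of
  \<open>k\<close> has its square in \<open>L v\<close>. This conjugate is represented by a shorter word, since elements of
  \<open>L v\<close> can be written without \<open>v\<close>; by induction it lies in \<open>L v\<close>, which contradicts
  \<open>geodesic_turn\<close>.\<close>

lemma parabolic_square_closed:
  assumes "S \<subseteq> V" "k \<in> carrier G" "k \<otimes> k \<in> parabolic S"
  shows "k \<in> parabolic S"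
proof -
  have *: "ev w \<in> parabolic S"
    if "geodesic w" "S \<subseteq> V" "ev w \<otimes> ev w \<in> parabolic S" for w S
    using that
  proof (induction "length w" arbitrary: w S rule: less_induct)
    case less
    have w: "w \<in> words V" using less.prems geodesicD by blast
    show ?case
    proof (cases "w \<in> words S")
      case True
      then show ?thesis by (simp add: parabolic_def)
    next
      case False
      then have "\<exists>x\<in>set w. fst x \<notin> S" by (force simp: lists_eq_set)
      then obtain v where v: "v \<in> fst ` set w" "v \<notin> S" by auto
      then have vV: "v \<in> V" using w by (auto simp: lists_eq_set)
      define \<gamma> where "\<gamma> = crossings v \<one> w"
      have \<gamma>: "reduced \<gamma>" "carrier_path \<gamma>" "\<gamma> \<noteq> []"
        using reduced_crossings carrier_path_crossings crossings_eq_Nil less.prems(1) w v vV by (auto simp: \<gamma>_def)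
      obtain r where r: "r \<in> words S" "ev (w @ w) = ev r"
        using less.prems(3) w by (auto simp: parabolic_def ev_append)
      have rV: "r \<in> words V" using r less.prems(2) words_mono by blast
      have "crossings v \<one> r = []" using r v by (auto simp: crossings_eq_Nil lists_eq_set)
      then have "nf (crossings v \<one> (w @ w)) = []"
        using word_eq_crossings[of "w @ w" r v] r(2) rV w vV ev_eq_iff[of "w @ w" r] by auto
      then have "nf (\<gamma> @ translate (ev w) \<gamma>) = []"
        using nf_crossings_append[OF w w vV] \<gamma>(1) by (simp add: \<gamma>_def nf_reduced)
      moreover obtain a s b where "\<gamma> = a @ s" "translate (ev w) \<gamma> = inv_word s @ b"
        "nf (\<gamma> @ translate (ev w) \<gamma>) = a @ b"
        using nf_tripod[OF \<gamma>(1) reduced_translate[OF \<gamma>(2) _ \<gamma>(1)], of "ev w"] w by auto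
      ultimately have inv: "translate (ev w) \<gamma> = inv_word \<gamma>" by simp
      define n where "n = length \<gamma>"
      have n: "n > 0" using \<gamma>(3) by (simp add: n_def)
      have nth: "ev w \<star> fst (\<gamma> ! i) = fst (\<gamma> ! (n - 1 - i))" "snd (\<gamma> ! i) = (\<not> snd (\<gamma> ! (n - 1 - i)))"
        if "i < n" for i
      proof -
        have "inv_word \<gamma> ! i = flip (\<gamma> ! (n - 1 - i))"
          using that by (simp add: inv_word_def rev_nth n_def)
        then have "(ev w \<star> fst (\<gamma> ! i), snd (\<gamma> ! i)) = flip (\<gamma> ! (n - 1 - i))"
          using inv translate_nth[of i \<gamma> "ev w"] that by (simp add: n_def)
        then show "ev w \<star> fst (\<gamma> ! i) = fst (\<gamma> ! (n - 1 - i))" "snd (\<gamma> ! i) = (\<not> snd (\<gamma> ! (n - 1 - i)))"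
          by (simp_all add: flip_def)
      qed
      \<comment> \<open>a middle crossing would be mapped to itself with the opposite sign\<close>
      have "even n"
      proof (rule ccontr)
        assume "odd n"
        then have "n - 1 - n div 2 = n div 2" "n div 2 < n" by presburger+
        then show False using nth(2)[of "n div 2"] by simp
      qed
      then obtain m where m: "n = 2 * Suc m" using n by (metis evenE gr0_implies_Suc mult_0_right not_gr_zero)
      define x y where "x = \<gamma> ! m" and "y = \<gamma> ! Suc m"
      have swap: "ev w \<star> fst x = fst y" "ev w \<star> fst y = fst x" "snd y \<noteq> snd x"
        using nth[of m] nth[of "Suc m"] m by (auto simp: x_def y_def)
      have "\<gamma> = take m \<gamma> @ x # y # drop (Suc (Suc m)) \<gamma>"
        using m by (simp add: n_def x_def y_def Cons_nth_drop_Suc)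
      from adjacent_crossings[OF vV w this[unfolded \<gamma>_def] swap(3)] obtain p u q where
        pq: "w = p @ (v, snd x) # u @ (v, snd y) # q" and
        k: "ev w \<star> fst x = fst y \<longleftrightarrow>
          inv (ev u) \<otimes> (inv (ev (p @ [(v, snd x)])) \<otimes> ev w \<otimes> ev (p @ [(v, snd x)])) \<in> L v"
        "ev w \<star> fst y = fst x \<longleftrightarrow>
          inv (ev (p @ [(v, snd x)])) \<otimes> ev w \<otimes> ev (p @ [(v, snd x)]) \<otimes> ev u \<in> L v"
        using ev_closed[OF w] by metis
      define p' q' where "p' = p @ [(v, snd x)]" and "q' = (v, snd y) # q"
      have w': "w = p' @ u @ q'" using pq by (simp add: p'_def q'_def)
      have V: "p' \<in> words V" "u \<in> words V" "q' \<in> words V" using w w' by auto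
      have z: "inv (ev p') \<otimes> ev w \<otimes> ev p' = ev u \<otimes> ev (q' @ p')"
        unfolding w' using V by (simp add: ev_append m_assoc)
      have l: "ev (q' @ p') \<in> L v" and zu: "ev u \<otimes> ev (q' @ p') \<otimes> ev u \<in> L v"
        using k swap(1,2) z V unfolding p'_def[symmetric] by (simp_all add: m_assoc)
      have zz: "(ev u \<otimes> ev (q' @ p')) \<otimes> (ev u \<otimes> ev (q' @ p')) \<in> L v"
        using subgroup.m_closed[OF L_subgroup zu l] V by (simp add: m_assoc)
      \<comment> \<open>the link part of the conjugate is rewritten without the letter, which makes the word shorter\<close>
      define t where "t = u @ keep (link v) (q' @ p')"
      have t: "t \<in> words V" "ev t = ev u \<otimes> ev (q' @ p')"
        using V ev_keep_parabolic[OF link_subset _ l] keep_words(1)[of "q' @ p'" "link v"]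
        by (auto simp: t_def ev_append keep_words)
      have "length (keep (link v) q') \<le> length q'" "length (keep (link v) p') < length p'"
        using not_in_link[of v] by (auto simp: keep_def p'_def le_imp_less_Suc)
      then have "length t < length w" by (simp add: t_def w')
      moreover obtain t' where "geodesic t'" "ev t' = ev t" "length t' \<le> length t"
        using geodesic_exists[OF t(1)] by blast
      ultimately have "ev t \<in> L v"
        using less.hyps[of t' "link v"] link_subset zz t(2) by auto
      then have "ev t \<otimes> inv (ev (q' @ p')) \<in> L v"
        using l L_subgroup by (simp add: subgroup.m_closed subgroup.m_inv_closed)
      then have "ev u \<in> L v" using t(2) V by (simp add: m_assoc)
      then show ?thesis using geodesic_turn[of p v "snd x" u q] less.prems(1) pq swap(3) by auto
    qed
  qed
  obtain u where "u \<in> words V" "k = ev u" using assms(2) by (auto simp: carrier_eq)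
  then obtain w where "geodesic w" "ev w = k" using geodesic_exists by metis
  then show ?thesis using *[of w S] assms by auto
qed

text \<open>The element \<open>z\<close> conjugate to \<open>k\<close> satisfies \<open>z \<in> u L v\<close> and \<open>z u \<in> L v\<close>, so \<open>z\<^sup>2 \<in> L v\<close>,
  hence \<open>z \<in> L v\<close> and \<open>u \<in> L v\<close>.\<close>

lemma no_swap:
  assumes "geodesic w" "v \<in> V" "crossings v \<one> w = P @ x # y # Q" "snd y \<noteq> snd x"
    and "k \<in> carrier G" "k \<star> fst x = fst y" "k \<star> fst y = fst x"
  shows False
proof -
  have w: "w \<in> words V" using assms geodesicD by blast
  from adjacent_crossings[OF assms(2) w assms(3,4)] obtain p u q where
    pq: "w = p @ (v, snd x) # u @ (v, snd y) # q" and
    k: "k \<star> fst x = fst y \<longleftrightarrow>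
      inv (ev u) \<otimes> (inv (ev (p @ [(v, snd x)])) \<otimes> k \<otimes> ev (p @ [(v, snd x)])) \<in> L v"
    "k \<star> fst y = fst x \<longleftrightarrow>
      inv (ev (p @ [(v, snd x)])) \<otimes> k \<otimes> ev (p @ [(v, snd x)]) \<otimes> ev u \<in> L v"
    using assms(5) by metis
  define z where "z = inv (ev (p @ [(v, snd x)])) \<otimes> k \<otimes> ev (p @ [(v, snd x)])"
  have V: "u \<in> words V" "p @ [(v, snd x)] \<in> words V" using pq w by auto
  then have z: "z \<in> carrier G" using assms(5) unfolding z_def by (intro m_closed inv_closed ev_closed)
  have l: "inv (ev u) \<otimes> z \<in> L v" "z \<otimes> ev u \<in> L v" using k assms(6,7) by (simp_all add: z_def)
  have "(z \<otimes> ev u) \<otimes> (inv (ev u) \<otimes> z) \<in> L v" by (rule subgroup.m_closed[OF L_subgroup l(2,1)])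
  then have "z \<otimes> z \<in> L v" using z V by (simp add: m_assoc)
  then have "z \<in> L v" by (rule parabolic_square_closed[OF link_subset z])
  then have "inv z \<otimes> (z \<otimes> ev u) \<in> L v"
    using l L_subgroup by (simp add: subgroup.m_closed subgroup.m_inv_closed)
  then have "ev u \<in> L v" using z V by simp
  then show False using geodesic_turn[of p v "snd x" u q] assms(1,4) pq by auto
qed

section \<open>The counting quasimorphism\<close>

definition crossing_path :: "'v \<Rightarrow> 'v word set \<Rightarrow> ('v word set set \<times> bool) list" where
  "crossing_path v g = nf (crossings v \<one> (SOME w. w \<in> words V \<and> ev w = g))"

lemma crossing_path_ev:
  assumes "w \<in> words V" "v \<in> V"
  shows "crossing_path v (ev w) = nf (crossings v \<one> w)"
proof -
  define u where "u = (SOME u. u \<in> words V \<and> ev u = ev w)"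
  have "u \<in> words V \<and> ev u = ev w" unfolding u_def by (rule someI[of _ w]) (use assms in simp)
  then show ?thesis
    using word_eq_crossings[of u w v] assms ev_eq_iff[of u w] by (simp add: crossing_path_def u_def)
qed

lemma crossing_path_mult:
  assumes "x \<in> carrier G" "y \<in> carrier G" "v \<in> V"
  shows "crossing_path v (x \<otimes> y) = nf (crossing_path v x @ translate x (crossing_path v y))"
proof -
  obtain u w where uw: "u \<in> words V" "w \<in> words V" "x = ev u" "y = ev w"
    using assms by (auto simp: carrier_eq)
  then have "x \<otimes> y = ev (u @ w)" by (simp add: ev_append)
  then show ?thesis
    using uw assms(3) nf_crossings_append[of u w v] crossing_path_ev by simp
qed

lemma crossing_path_carrier:
  assumes "x \<in> carrier G" "v \<in> V"
  shows "carrier_path (crossing_path v x)" "reduced (crossing_path v x)"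
proof -
  obtain u where u: "u \<in> words V" "x = ev u" using assms by (auto simp: carrier_eq)
  then show "carrier_path (crossing_path v x)"
    using nf_translate(2)[OF carrier_path_crossings one_closed] assms(2) by (simp add: crossing_path_ev)
  show "reduced (crossing_path v x)" by (simp add: crossing_path_def)
qed

lemma tally_quasimorphism:
  assumes "v \<in> V" "carrier_path \<gamma>" "\<gamma> \<noteq> []" "x \<in> carrier G" "y \<in> carrier G"
  shows "\<bar>tally (orbit \<gamma>) (crossing_path v (x \<otimes> y)) - tally (orbit \<gamma>) (crossing_path v x)
    - tally (orbit \<gamma>) (crossing_path v y)\<bar> \<le> 3"
proof -
  have "[] \<notin> orbit \<gamma>" using assms(3) by (metis (no_types, lifting) imageE orbit_def translate_simps(5))
  then show ?thesis
    using tally_nf_append[of "orbit \<gamma>" "crossing_path v x" "translate x (crossing_path v y)"]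
      assms crossing_path_carrier[of _ v] reduced_translate tally_translate crossing_path_mult
    by simp
qed

section \<open>The axis of a shortest word in its conjugacy class\<close>

definition cyclically_geodesic :: "'v word \<Rightarrow> bool" where
  "cyclically_geodesic w \<longleftrightarrow> w \<in> words V \<and>
     (\<forall>u\<in>words V. \<forall>k\<in>carrier G. ev u = k \<otimes> ev w \<otimes> inv k \<longrightarrow> length w \<le> length u)"

lemma cyclically_geodesic_imp_geodesic: "cyclically_geodesic w \<Longrightarrow> geodesic w"
  unfolding cyclically_geodesic_def geodesic_def by (metis ev_closed inv_one l_one one_closed r_one)

lemma cyclically_geodesic_exists:
  assumes "g \<in> carrier G"
  obtains w k where "cyclically_geodesic w" "k \<in> carrier G" "ev w = k \<otimes> g \<otimes> inv k"
proof -
  let ?P = "\<lambda>w. w \<in> words V \<and> (\<exists>k\<in>carrier G. ev w = k \<otimes> g \<otimes> inv k)"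
  obtain u where "u \<in> words V" "g = ev u" using assms by (auto simp: carrier_eq)
  then have "?P u" by (auto intro: bexI[of _ \<one>])
  then obtain w where w: "?P w" "\<forall>x. ?P x \<longrightarrow> length w \<le> length x"
    using ex_has_least_nat[of ?P u length] by auto
  obtain k where k: "k \<in> carrier G" "ev w = k \<otimes> g \<otimes> inv k" using w(1) by auto
  have "cyclically_geodesic w"
    unfolding cyclically_geodesic_def
  proof (intro conjI ballI impI)
    fix u j assume *: "u \<in> words V" "j \<in> carrier G" "ev u = j \<otimes> ev w \<otimes> inv j"
    then have "ev u = (j \<otimes> k) \<otimes> g \<otimes> inv (j \<otimes> k)"
      using k assms by (simp add: inv_mult_group m_assoc)
    then show "length w \<le> length u" using w(2) * k by blast
  qed (use w in simp)
  then show thesis using that k by blast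
qed

definition word_power :: "'v word \<Rightarrow> nat \<Rightarrow> 'v word" where
  "word_power w n = concat (replicate n w)"

lemma word_power_simps [simp]: "word_power w 0 = []" "word_power w (Suc n) = w @ word_power w n"
  by (simp_all add: word_power_def)

lemma word_power_words: "w \<in> words V \<Longrightarrow> word_power w n \<in> words V"
  by (induction n) auto

lemma ev_word_power: "w \<in> words V \<Longrightarrow> ev (word_power w n) = ev w [^] n"
proof (induction n)
  case (Suc n)
  then show ?case using nat_pow_Suc2[of "ev w" n] by (simp add: ev_append word_power_words)
qed simp

definition axis_path :: "'v \<Rightarrow> 'v word \<Rightarrow> nat \<Rightarrow> ('v word set set \<times> bool) list" where
  "axis_path v w n = crossings v \<one> (word_power w n)"

lemma axis_simps:
  assumes "w \<in> words V" "v \<in> V"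
  shows "axis_path v w 0 = []"
    "axis_path v w (Suc n) = crossings v \<one> w @ translate (ev w) (axis_path v w n)"
  using assms crossings_append[of \<one> w "word_power w n" v]
    crossings_translate[of \<one> "ev w" v "word_power w n"] word_power_words[of w n]
  by (simp_all add: axis_path_def)

lemma axis_nth:
  assumes "w \<in> words V" "v \<in> V" "i < n * length (crossings v \<one> w)"
  defines "N \<equiv> length (crossings v \<one> w)"
  shows "axis_path v w n ! i = (ev w [^] (i div N) \<star> fst (crossings v \<one> w ! (i mod N)),
    snd (crossings v \<one> w ! (i mod N)))"
    and "length (axis_path v w n) = n * N"
proof -
  let ?\<gamma> = "crossings v \<one> w"
  have good: "carrier_path ?\<gamma>" using carrier_path_crossings assms by simp
  show len: "length (axis_path v w n) = n * N" for n
    by (induction n) (simp_all add: axis_simps assms N_def)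
  show "axis_path v w n ! i = (ev w [^] (i div N) \<star> fst (?\<gamma> ! (i mod N)), snd (?\<gamma> ! (i mod N)))"
    using assms(3)[folded N_def]
  proof (induction n arbitrary: i)
    case (Suc n)
    show ?case
    proof (cases "i < N")
      case True
      then have "axis_path v w (Suc n) ! i = ?\<gamma> ! i"
        using assms by (simp add: axis_simps nth_append N_def)
      moreover have "\<one> \<star> fst (?\<gamma> ! i) = fst (?\<gamma> ! i)"
        using carrier_path_nth[OF good] True by (simp add: lcos_mult_one N_def)
      ultimately show ?thesis using True by simp
    next
      case False
      define j where "j = i - N"
      have j: "i = N + j" "j < n * N" "N > 0" using False Suc.prems
        by (auto simp: j_def) (metis add_0 gr0I mult_0_right not_less_zero)
      have "j mod N < length ?\<gamma>" using j(3) by (simp add: N_def)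
      then have sub: "fst (?\<gamma> ! (j mod N)) \<subseteq> carrier G" by (rule carrier_path_nth[OF good])
      have "axis_path v w (Suc n) ! i = translate (ev w) (axis_path v w n) ! j"
        using assms j by (simp add: axis_simps nth_append N_def)
      also have "\<dots> = (ev w \<star> (ev w [^] (j div N) \<star> fst (?\<gamma> ! (j mod N))), snd (?\<gamma> ! (j mod N)))"
        using j(2) len Suc.IH[OF j(2)] by simp
      also have "ev w \<star> (ev w [^] (j div N) \<star> fst (?\<gamma> ! (j mod N))) =
          ev w [^] (Suc (j div N)) \<star> fst (?\<gamma> ! (j mod N))"
        using sub assms(1) nat_pow_Suc2[of "ev w" "j div N"] by (simp add: lcos_m_assoc)
      finally show ?thesis using j by simp
    qed
  qed simp
qed

text \<open>Inside a period the path is reduced because \<open>w\<close> is geodesic. Backtracking between two periods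
  would mean that the last letter \<open>v\<^sup>\<plusminus>\<^sup>1\<close> of \<open>w\<close> is \<open>v\<^sup>-\<^sup>s\<close>, followed by some \<open>q \<in> L v\<close>; then
  \<open>w = v\<^sup>s p\<^sub>1 v\<^sup>-\<^sup>s q\<close> is conjugate to the shorter \<open>p\<^sub>1 q\<close>.\<close>

lemma reduced_axis:
  assumes "cyclically_geodesic w" "w = (v, s) # t"
  shows "reduced (axis_path v w n)"
proof -
  let ?\<gamma> = "crossings v \<one> w"
  have geo: "geodesic w" using assms(1) by (rule cyclically_geodesic_imp_geodesic)
  have w: "w \<in> words V" "v \<in> V" "t \<in> words V" using geodesicD(1)[OF geo] assms(2) by auto
  have hd: "?\<gamma> \<noteq> []" "hd ?\<gamma> = (hyperplane v \<one> s, s)" using assms(2) by simp_all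
  \<comment> \<open>the seam between two consecutive periods\<close>
  have no_backtrack: "(ev w \<star> hyperplane v \<one> s, s) \<noteq> flip (last ?\<gamma>)"
  proof
    assume *: "(ev w \<star> hyperplane v \<one> s, s) = flip (last ?\<gamma>)"
    define x where "x = last ?\<gamma>"
    have "?\<gamma> = butlast ?\<gamma> @ x # []" using hd(1) by (simp add: x_def)
    from crossings_split[OF this] obtain p q where pq: "w = p @ (v, snd x) # q"
      "fst x = hyperplane v (\<one> \<otimes> ev p) (snd x)" using w by auto
    have x: "snd x = (\<not> s)" "fst x = ev w \<star> hyperplane v \<one> s"
      using * by (auto simp: flip_def x_def)
    have V: "p \<in> words V" "q \<in> words V" using pq(1) w by auto
    have "ev w = ev p \<otimes> ev [(v, \<not> s)] \<otimes> ev q"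
      unfolding pq(1) x(1) using V w ev_append[of p "(v, \<not> s) # q"] ev_Cons[of "(v, \<not> s)" q]
      by (simp add: m_assoc)
    then have "hyperplane v (ev p \<otimes> ev [(v, \<not> s)] \<otimes> ev q) (\<not> \<not> s) = hyperplane v (ev p) (\<not> s)"
      using pq(2) x hyperplane_translate[of \<one> "ev w" v s] w V by simp
    then have "\<one> \<star> hyperplane v (ev p \<otimes> ev [(v, \<not> s)] \<otimes> ev q) (\<not> \<not> s) = hyperplane v (ev p) (\<not> s)"
      using hyperplane_subset[of _ v] w V by (simp add: lcos_mult_one)
    then have "ev q \<in> L v"
      using hyperplane_turn(2)[of v "ev p" "ev q" \<one> "\<not> s"] w V by simp
    note q = this
    have "p \<noteq> []" using pq(1) x(1) assms(2) by auto
    then obtain p1 where p1: "p = (v, s) # p1" using pq(1) assms(2) by (cases p) auto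
    have pV: "p1 \<in> words V" using V p1 by simp
    have "inv (ev [(v, s)]) \<otimes> ev w \<otimes> inv (inv (ev [(v, s)])) =
        inv (ev [(v, s)]) \<otimes> (ev [(v, s)] \<otimes> ev p1 \<otimes> inv (ev [(v, s)]) \<otimes> ev q) \<otimes> ev [(v, s)]"
      using \<open>ev w = ev p \<otimes> ev [(v, \<not> s)] \<otimes> ev q\<close> p1 pV w ev_Cons[of "(v, s)" p1] ev_inv_letter[of v s] by simp
    also have "\<dots> = ev p1 \<otimes> (inv (ev [(v, s)]) \<otimes> (ev q \<otimes> ev [(v, s)]))"
      using pV V w by (simp add: m_assoc)
    also have "\<dots> = ev p1 \<otimes> ev q"
      using V w by (simp flip: L_commute[OF w(2) q])
    also have "\<dots> = ev (p1 @ q)" using pV V by (simp add: ev_append)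
    finally have "ev (p1 @ q) = inv (ev [(v, s)]) \<otimes> ev w \<otimes> inv (inv (ev [(v, s)]))" by simp
    moreover have "p1 @ q \<in> words V" "inv (ev [(v, s)]) \<in> carrier G" using pV V w by auto
    ultimately have "length w \<le> length (p1 @ q)"
      using assms(1) unfolding cyclically_geodesic_def by blast
    then show False using pq(1) p1 by simp
  qed
  show ?thesis
  proof (induction n)
    case (Suc n)
    have good: "carrier_path (axis_path v w n)"
      unfolding axis_path_def using w by (intro carrier_path_crossings word_power_words) auto
    have "n > 0 \<Longrightarrow> hd (axis_path v w n) = (hyperplane v \<one> s, s) \<and> axis_path v w n \<noteq> []"
      using axis_simps(2)[OF w(1,2), of "n - 1"] hd by (cases n) (simp_all add: hd_append)
    moreover have "n = 0 \<Longrightarrow> axis_path v w n = []" using axis_simps[OF w(1,2)] by simp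
    ultimately have "axis_path v w n \<noteq> [] \<Longrightarrow> hd (translate (ev w) (axis_path v w n)) = (ev w \<star> hyperplane v \<one> s, s)"
      by (cases "n = 0"; cases "axis_path v w n") auto
    then show ?case
      using reduced_translate[OF good _ Suc] reduced_crossings[OF geo w(2)] no_backtrack w
      by (auto simp: axis_simps successively_append_iff)
  qed (simp add: axis_simps w)
qed

lemma packs_axis:
  assumes "w \<in> words V" "v \<in> V"
  shows "packs (orbit (crossings v \<one> w)) (axis_path v w n) n"
proof (induction n)
  case (Suc n)
  let ?\<gamma> = "crossings v \<one> w"
  have good: "carrier_path ?\<gamma>" using assms carrier_path_crossings by simp
  then have "?\<gamma> \<in> orbit ?\<gamma>" unfolding orbit_def by (metis imageI one_closed translate_one)
  then have "packs (orbit ?\<gamma>) ?\<gamma> 1" by simp (metis append_Nil append_Nil2)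
  moreover have "packs (orbit ?\<gamma>) (translate (ev w) (axis_path v w n)) n"
    using packs_translate[OF good _ Suc] assms(1) by simp
  ultimately have "packs (orbit ?\<gamma>) (?\<gamma> @ translate (ev w) (axis_path v w n)) (1 + n)"
    by (rule packs_append)
  then show ?case using assms by (simp add: axis_simps)
qed simp

text \<open>Write the offset of the occurrence as \<open>j N + r\<close> with \<open>r < N\<close>, where \<open>N\<close> is the length of a
  period. Dividing by the \<open>j\<close>-th power of \<open>w\<close>, the occurrence reflects the positions of the axis
  by \<open>i \<mapsto> r + N - 1 - i\<close> and reverses signs. If \<open>r + N - 1\<close> is even, the middle crossing would be its
  own image with the sign changed; if it is odd, two neighbouring crossings within one period are
  interchanged, against \<open>no_swap\<close>.\<close>

lemma axis_no_inverse:
  assumes "geodesic w" "v \<in> V" "crossings v \<one> w \<noteq> []" "k \<in> carrier G"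
    and occ: "axis_path v w n = A @ translate k (inv_word (crossings v \<one> w)) @ B"
  shows False
proof -
  define \<gamma> where "\<gamma> = crossings v \<one> w"
  define N where "N = length \<gamma>"
  have w: "w \<in> words V" using assms geodesicD by blast
  have N: "N > 0" using assms(3) by (simp add: N_def \<gamma>_def)
  have good: "carrier_path \<gamma>" using carrier_path_crossings assms(2) w by (simp add: \<gamma>_def)
  define r j where "r = length A mod N" and "j = length A div N"
  define g where "g = ev w [^] j"
  have g: "g \<in> carrier G" using w by (simp add: g_def)
  have A: "length A = j * N + r" "r < N" using N by (simp_all add: r_def j_def)
  have len: "length A + N \<le> n * N"
  proof (cases "n * N > 0")
    case True
    then have "length (axis_path v w n) = n * N" using axis_nth(2)[OF w assms(2), of 0 n] by (simp add: N_def \<gamma>_def)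
    then show ?thesis using occ by (simp add: N_def \<gamma>_def)
  next
    case False
    then have "n = 0" using N by simp
    then show ?thesis using occ axis_simps(1)[OF w assms(2)] assms(3) by simp
  qed
  have refl: "g \<star> fst (\<gamma> ! (r + N - 1 - i)) = k \<star> fst (\<gamma> ! i)" "snd (\<gamma> ! (r + N - 1 - i)) = (\<not> snd (\<gamma> ! i))"
    if i: "i < N" "r \<le> i" for i
  proof -
    define m where "m = r + N - 1 - i"
    have m: "m < N" using i by (simp add: m_def)
    have pos: "j * N + m = length A + (N - 1 - i)" using A i by (simp add: m_def)
    have lt: "N - 1 - i < length (inv_word \<gamma>)" using i by (simp add: N_def)
    have "axis_path v w n ! (j * N + m) = translate k (inv_word \<gamma>) ! (N - 1 - i)"
      unfolding pos occ \<gamma>_def[symmetric] using lt by (subst nth_append_length_plus, subst nth_append) simp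
    also have "\<dots> = (k \<star> fst (inv_word \<gamma> ! (N - 1 - i)), snd (inv_word \<gamma> ! (N - 1 - i)))"
      by (rule translate_nth[OF lt])
    also have "inv_word \<gamma> ! (N - 1 - i) = flip (\<gamma> ! i)"
      using i by (simp add: inv_word_def rev_nth N_def)
    finally have 1: "axis_path v w n ! (j * N + m) = (k \<star> fst (\<gamma> ! i), \<not> snd (\<gamma> ! i))" by simp
    have lt: "j * N + m < n * N" using pos len i by simp
    have "axis_path v w n ! (j * N + m) = (g \<star> fst (\<gamma> ! m), snd (\<gamma> ! m))"
      using axis_nth(1)[OF w assms(2) lt[unfolded N_def \<gamma>_def], folded \<gamma>_def, folded N_def] m
      by (simp add: g_def)
    then show "g \<star> fst (\<gamma> ! (r + N - 1 - i)) = k \<star> fst (\<gamma> ! i)"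
      "snd (\<gamma> ! (r + N - 1 - i)) = (\<not> snd (\<gamma> ! i))"
      using 1 by (simp_all add: m_def)
  qed
  show False
  proof (cases "even (r + N - 1)")
    case True
    then obtain m where m: "r + N - 1 = 2 * m" by blast
    then have "m < N" "r \<le> m" "r + N - 1 - m = m" using A(2) by linarith+
    then show False using refl(2)[of m] by simp
  next
    case False
    then obtain m where m: "r + N - 1 = 2 * m + 1" by (metis oddE)
    then have lt: "Suc m < N" "r \<le> m" "r + N - 1 - m = Suc m" "r + N - 1 - Suc m = m"
      using A(2) by linarith+
    define x y where "x = \<gamma> ! m" and "y = \<gamma> ! Suc m"
    have sub: "fst x \<subseteq> carrier G" "fst y \<subseteq> carrier G"
      using carrier_path_nth[OF good] lt(1) by (auto simp: x_def y_def N_def)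
    have e: "g \<star> fst y = k \<star> fst x" "g \<star> fst x = k \<star> fst y" "snd y \<noteq> snd x"
      using refl[of m] refl[of "Suc m"] lt by (simp_all add: x_def y_def)
    have "inv g \<star> (g \<star> C) = C" if "C \<subseteq> carrier G" for C
      using that g by (simp add: lcos_m_assoc lcos_mult_one)
    then have "inv g \<otimes> k \<star> fst x = fst y" "inv g \<otimes> k \<star> fst y = fst x"
      using sub g assms(4) e lcos_m_assoc by (metis inv_closed)+
    moreover have "crossings v \<one> w = take m \<gamma> @ x # y # drop (Suc (Suc m)) \<gamma>"
      using lt(1) unfolding \<gamma>_def[symmetric] x_def y_def N_def
      by (metis Cons_nth_drop_Suc Suc_lessD append_take_drop_id)
    ultimately show False
      using no_swap[OF assms(1,2) _ e(3), of _ _ "inv g \<otimes> k"] g assms(4) by auto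
  qed
qed

text \<open>Since \<open>comm_prods m\<close> is invariant under conjugation, the element \<open>g\<close> may be replaced by the
  conjugate that is represented by a shortest word.\<close>

theorem commutator_gap:
  assumes "g \<in> carrier G" "g \<noteq> \<one>" "g [^] (n::nat) \<in> comm_prods m"
  shows "n \<le> 12 * m"
proof -
  obtain w k where w: "cyclically_geodesic w" "k \<in> carrier G" "ev w = k \<otimes> g \<otimes> inv k"
    using cyclically_geodesic_exists[OF assms(1)] by blast
  have geo: "geodesic w" using w(1) by (rule cyclically_geodesic_imp_geodesic)
  have "w \<noteq> []"
  proof
    assume "w = []"
    then have "k \<otimes> g = k" using w assms(1) by (simp add: inv_solve_right)
    then show False using w(2) assms(1,2) by simp
  qed
  then obtain v s t where vst: "w = (v, s) # t" by (metis list.exhaust surj_pair)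
  have V: "w \<in> words V" "v \<in> V" using geodesicD(1)[OF geo] vst by auto
  define \<gamma> where "\<gamma> = crossings v \<one> w"
  define H where "H x = tally (orbit \<gamma>) (crossing_path v x)" for x
  have \<gamma>: "carrier_path \<gamma>" "\<gamma> \<noteq> []"
    using carrier_path_crossings[of \<one> v w] V crossings_eq_Nil[of v \<one> w] vst by (simp_all add: \<gamma>_def)
  have Q: "[] \<notin> orbit p" if "p \<noteq> []" for p
    using that by (metis (no_types, lifting) imageE orbit_def translate_simps(5))
  have path: "crossing_path v (ev w [^] n) = axis_path v w n"
    using crossing_path_ev[of "word_power w n" v] ev_word_power[OF V(1), of n]
      word_power_words[OF V(1), of n] nf_reduced[OF reduced_axis[OF w(1) vst, of n]] V(2)
    by (simp add: axis_path_def)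
  have "n \<le> packing_number (orbit \<gamma>) (axis_path v w n)"
    using le_packing_number[OF Q[OF \<gamma>(2)]] packs_axis[OF V, of n] by (simp add: \<gamma>_def)
  moreover have "packing_number (orbit (inv_word \<gamma>)) (axis_path v w n) = 0"
  proof -
    have "\<not> packs (orbit (inv_word \<gamma>)) (axis_path v w n) (Suc i)" for i
      using axis_no_inverse[OF geo V(2), of _ n] \<gamma>(2) unfolding \<gamma>_def orbit_def packs.simps by blast
    moreover have "packs (orbit (inv_word \<gamma>)) (axis_path v w n) (packing_number (orbit (inv_word \<gamma>)) (axis_path v w n))"
      using packs_packing_number Q[of "inv_word \<gamma>"] \<gamma>(2) by simp
    ultimately show ?thesis by (metis not0_implies_Suc)
  qed
  ultimately have "int n \<le> H (ev w [^] n)"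
    by (simp add: H_def path tally_def inv_word_orbit)
  moreover have "\<bar>H (ev w [^] n)\<bar> \<le> 4 * 3 * int m"
  proof (rule quasimorphism_comm_prods)
    show "\<bar>H (x \<otimes> y) - H x - H y\<bar> \<le> 3" if "x \<in> carrier G" "y \<in> carrier G" for x y
      unfolding H_def using tally_quasimorphism[OF V(2) \<gamma> that] .
    have "packs Q [] i \<Longrightarrow> [] \<notin> Q \<Longrightarrow> i = 0" for Q :: "('v word set set \<times> bool) list set" and i
      using packs_le_length[of Q "[]" i] by simp
    then have "packing_number (orbit p) [] = 0" if "p \<noteq> []" for p
      using packs_packing_number[OF Q[OF that], of "[]"] Q[OF that] by blast
    moreover have "crossing_path v \<one> = []" using crossing_path_ev[of "[]" v] V by simp
    ultimately show "H \<one> = 0" using \<gamma>(2) by (simp add: H_def tally_def inv_word_orbit)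
    show "ev w [^] n \<in> comm_prods m"
      using comm_prods_conj[OF assms(3) w(2)] nat_pow_conj[OF assms(1) w(2), of n] w(3) by simp
  qed
  ultimately show ?thesis by linarith
qed

end

section \<open>Fundamental group\<close>

definition path_between :: "'x::topological_space set \<Rightarrow> 'x \<Rightarrow> 'x \<Rightarrow> (real \<Rightarrow> 'x) \<Rightarrow> bool" where
  "path_between X x y p \<longleftrightarrow> path p \<and> path_image p \<subseteq> X \<and> pathstart p = x \<and> pathfinish p = y"

abbreviation is_loop :: "'x::topological_space set \<Rightarrow> 'x \<Rightarrow> (real \<Rightarrow> 'x) \<Rightarrow> bool" where
  "is_loop X x \<equiv> path_between X x x"

lemma path_between_join: "path_between X x y p \<Longrightarrow> path_between X y z q \<Longrightarrow> path_between X x z (p +++ q)"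
  by (simp add: path_between_def subset_path_image_join)

lemma path_between_reversepath: "path_between X x y p \<Longrightarrow> path_between X y x (reversepath p)"
  by (simp add: path_between_def)

lemma is_loop_const: "x \<in> X \<Longrightarrow> is_loop X x (\<lambda>_. x)"
  by (auto simp: path_between_def path_def path_image_def pathstart_def pathfinish_def)

lemma path_between_refl: "path_between X x y p \<Longrightarrow> homotopic_paths X p p"
  by (simp add: path_between_def)

lemma path_between_cong: "path_between X x y p \<Longrightarrow> homotopic_paths X p q \<Longrightarrow> path_between X x y q"
  unfolding path_between_def
  by (metis homotopic_paths_imp_path homotopic_paths_imp_pathfinish homotopic_paths_imp_pathstart
      homotopic_paths_imp_subset)

lemma homotopic_join:
  "path_between X x y p \<Longrightarrow> path_between X y z q \<Longrightarrow> homotopic_paths X p p' \<Longrightarrow> homotopic_paths X q q' \<Longrightarrow>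
    homotopic_paths X (p +++ q) (p' +++ q')"
  by (simp add: path_between_def homotopic_paths_join)

lemma homotopic_assoc:
  "path_between X x y p \<Longrightarrow> path_between X y z q \<Longrightarrow> path_between X z w r \<Longrightarrow>
    homotopic_paths X ((p +++ q) +++ r) (p +++ (q +++ r))"
  by (rule homotopic_paths_sym, rule homotopic_paths_assoc) (auto simp: path_between_def)

lemma loop_class_eq_iff:
  assumes "is_loop X x p"
  shows "loop_class X p = loop_class X q \<longleftrightarrow> homotopic_paths X p q"
proof
  assume *: "loop_class X p = loop_class X q"
  have "homotopic_paths X p p" using assms by (simp add: path_between_def)
  then have "homotopic_paths X q p" using * by (auto simp: loop_class_def)
  then show "homotopic_paths X p q" by (rule homotopic_paths_sym)
next
  assume "homotopic_paths X p q"
  then show "loop_class X p = loop_class X q"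
    unfolding loop_class_def by (blast intro: homotopic_paths_trans homotopic_paths_sym)
qed

lemma carrier_fundamental_group: "carrier (fundamental_group X x) = {loop_class X p | p. is_loop X x p}"
  by (simp add: fundamental_group_def path_between_def)

lemma one_fundamental_group: "\<one>\<^bsub>fundamental_group X x\<^esub> = loop_class X (\<lambda>_. x)"
  by (simp add: fundamental_group_def)

lemma mult_fundamental_group:
  assumes "is_loop X x p" "is_loop X x q"
  shows "loop_class X p \<otimes>\<^bsub>fundamental_group X x\<^esub> loop_class X q = loop_class X (p +++ q)"
proof -
  have "(\<exists>p'. homotopic_paths X p p' \<and> (\<exists>q'. homotopic_paths X q q' \<and> homotopic_paths X (p' +++ q') r))
    \<longleftrightarrow> homotopic_paths X (p +++ q) r" for r
  proof
    assume "\<exists>p'. homotopic_paths X p p' \<and> (\<exists>q'. homotopic_paths X q q' \<and> homotopic_paths X (p' +++ q') r)"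
    then obtain p' q' where "homotopic_paths X p p'" "homotopic_paths X q q'" "homotopic_paths X (p' +++ q') r"
      by blast
    then show "homotopic_paths X (p +++ q) r"
      using homotopic_paths_join assms homotopic_paths_trans by (metis path_between_def)
  next
    assume "homotopic_paths X (p +++ q) r"
    moreover have "homotopic_paths X p p" "homotopic_paths X q q" using assms by (simp_all add: path_between_def)
    ultimately show "\<exists>p'. homotopic_paths X p p' \<and> (\<exists>q'. homotopic_paths X q q' \<and> homotopic_paths X (p' +++ q') r)"
      by blast
  qed
  then show ?thesis by (simp add: fundamental_group_def loop_class_def)
qed

text \<open>The space is an arbitrary topological space, so the trivial loop is a constant function and
  homotopies are obtained by reparametrising, or by composing with homotopies between paths in an
  interval.\<close>

lemma homotopic_const_left:
  assumes "path p" "path_image p \<subseteq> X" "x = pathstart p"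
  shows "homotopic_paths X ((\<lambda>_. x) +++ p) p"
proof -
  have "continuous_on {0..1::real} (\<lambda>t. if t \<le> 1/2 then 0 else 2 * t - 1)"
    by (rule continuous_on_cases_1 continuous_intros | auto)+
  then have "homotopic_paths X p ((\<lambda>_. x) +++ p)"
    using assms by (intro homotopic_paths_reparametrize[where f = "\<lambda>t. if t \<le> 1/2 then 0 else 2 * t - 1"])
      (auto simp: joinpaths_def pathstart_def)
  then show ?thesis by (rule homotopic_paths_sym)
qed

lemma homotopic_rinv:
  assumes "path_between X x y p"
  shows "homotopic_paths X (p +++ reversepath p) (\<lambda>_. x)"
proof -
  have "homotopic_paths {0..1} (linepath 0 1 +++ reversepath (linepath 0 1)) (linepath 0 (0::real))"
    using homotopic_paths_rinv[of "linepath 0 (1::real)" "{0..1}"] by (simp add: closed_segment_eq_real_ivl)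
  then have "homotopic_paths X (p \<circ> (linepath 0 1 +++ reversepath (linepath 0 1))) (p \<circ> linepath 0 0)"
    using assms by (intro homotopic_paths_continuous_image[where S = "{0..1}"])
      (auto simp: path_between_def path_def path_image_def)
  moreover have "p \<circ> linepath 0 1 = p" "p \<circ> linepath 0 0 = (\<lambda>_. x)"
    using assms by (auto simp: linepath_def path_between_def pathstart_def)
  ultimately show ?thesis by (simp add: path_compose_join path_compose_reversepath del: reversepath_linepath)
qed

lemma homotopic_linv:
  assumes "path_between X x y p"
  shows "homotopic_paths X (reversepath p +++ p) (\<lambda>_. y)"
  using homotopic_rinv[OF path_between_reversepath[OF assms]] by simp

lemma group_fundamental_group:
  assumes "x \<in> X"
  shows "group (fundamental_group X x)"
proof (rule groupI)
  let ?G = "fundamental_group X x"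
  show "a \<otimes>\<^bsub>?G\<^esub> b \<in> carrier ?G" if "a \<in> carrier ?G" "b \<in> carrier ?G" for a b
    using that unfolding carrier_fundamental_group
    by (auto simp: mult_fundamental_group intro: path_between_join)
  show one: "\<one>\<^bsub>?G\<^esub> \<in> carrier ?G"
    using is_loop_const[OF assms] unfolding carrier_fundamental_group one_fundamental_group by blast
  show "a \<otimes>\<^bsub>?G\<^esub> b \<otimes>\<^bsub>?G\<^esub> c = a \<otimes>\<^bsub>?G\<^esub> (b \<otimes>\<^bsub>?G\<^esub> c)"
    if abc: "a \<in> carrier ?G" "b \<in> carrier ?G" "c \<in> carrier ?G" for a b c
  proof -
    obtain p q r where l: "is_loop X x p" "is_loop X x q" "is_loop X x r"
      and "a = loop_class X p" "b = loop_class X q" "c = loop_class X r"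
      using abc unfolding carrier_fundamental_group by auto
    then show ?thesis
      using iffD2[OF loop_class_eq_iff[OF path_between_join[OF path_between_join[OF l(1,2)] l(3)]]
          homotopic_assoc[OF l]]
      by (simp add: mult_fundamental_group path_between_join[of X x x _ x])
  qed
  show "\<one>\<^bsub>?G\<^esub> \<otimes>\<^bsub>?G\<^esub> a = a" if a: "a \<in> carrier ?G" for a
  proof -
    obtain p where l: "is_loop X x p" and "a = loop_class X p"
      using a unfolding carrier_fundamental_group by auto
    moreover have "homotopic_paths X ((\<lambda>_. x) +++ p) p"
      using l by (intro homotopic_const_left) (auto simp: path_between_def)
    moreover have "is_loop X x ((\<lambda>_. x) +++ p)"
      using path_between_join[OF is_loop_const[OF assms] l] .
    ultimately show ?thesis
      by (simp add: one_fundamental_group mult_fundamental_group[OF is_loop_const[OF assms] l] loop_class_eq_iff)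
  qed
  show "\<exists>b\<in>carrier ?G. b \<otimes>\<^bsub>?G\<^esub> a = \<one>\<^bsub>?G\<^esub>" if a: "a \<in> carrier ?G" for a
  proof -
    obtain p where l: "is_loop X x p" and a: "a = loop_class X p"
      using a unfolding carrier_fundamental_group by auto
    have r: "is_loop X x (reversepath p)" by (rule path_between_reversepath[OF l])
    have "loop_class X (reversepath p) \<otimes>\<^bsub>?G\<^esub> a = \<one>\<^bsub>?G\<^esub>"
      using homotopic_linv[OF l] path_between_join[OF r l]
      by (simp add: a mult_fundamental_group[OF r l] one_fundamental_group loop_class_eq_iff)
    moreover have "loop_class X (reversepath p) \<in> carrier ?G"
      using r unfolding carrier_fundamental_group by blast
    ultimately show ?thesis by blast
  qed
qed

lemma convex_homotopic_paths:
  fixes S :: "'a::real_normed_vector set"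
  assumes "convex S" "path_between S x y p" "path_between S x y q"
  shows "homotopic_paths S p q"
  using convex_imp_simply_connected[OF assms(1)] assms(2,3)
  unfolding simply_connected_eq_homotopic_paths path_between_def by auto

text \<open>The isomorphism of fundamental groups along a path \<open>\<tau>\<close> from the new base point to the old
  one, with the new class as value. It is needed because the corner of the polygon need not be
  mapped to \<open>x0\<close>.\<close>

definition base_change :: "'x::topological_space set \<Rightarrow> (real \<Rightarrow> 'x) \<Rightarrow> (real \<Rightarrow> 'x) \<Rightarrow> (real \<Rightarrow> 'x) set" where
  "base_change X \<tau> l = loop_class X (\<tau> +++ (l +++ reversepath \<tau>))"

context
  fixes X :: "'x::topological_space set" and x y :: 'x and \<tau> :: "real \<Rightarrow> 'x"
  assumes \<tau>: "path_between X x y \<tau>"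
begin

lemma base_change_loop:
  "is_loop X y l \<Longrightarrow> is_loop X x (\<tau> +++ (l +++ reversepath \<tau>))"
  using \<tau> by (intro path_between_join path_between_reversepath)

lemma base_change_closed: "is_loop X y l \<Longrightarrow> base_change X \<tau> l \<in> carrier (fundamental_group X x)"
  using base_change_loop unfolding base_change_def carrier_fundamental_group by blast

lemma base_change_cong:
  assumes "is_loop X y l" "homotopic_paths X l l'"
  shows "base_change X \<tau> l = base_change X \<tau> l'"
proof -
  have r: "path_between X y x (reversepath \<tau>)" by (rule path_between_reversepath[OF \<tau>])
  have "homotopic_paths X (\<tau> +++ (l +++ reversepath \<tau>)) (\<tau> +++ (l' +++ reversepath \<tau>))"
    using homotopic_join[OF \<tau> path_between_join[OF assms(1) r] path_between_refl[OF \<tau>]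
        homotopic_join[OF assms(1) r assms(2) path_between_refl[OF r]]] .
  then show ?thesis
    unfolding base_change_def by (simp add: loop_class_eq_iff[OF base_change_loop[OF assms(1)]])
qed

lemma base_change_mult:
  assumes "is_loop X y k" "is_loop X y l"
  shows "base_change X \<tau> k \<otimes>\<^bsub>fundamental_group X x\<^esub> base_change X \<tau> l = base_change X \<tau> (k +++ l)"
proof -
  let ?r = "reversepath \<tau>"
  note [intro] = path_between_join path_between_reversepath path_between_refl
  have r: "path_between X y x ?r" using \<tau> by blast
  have lr: "path_between X y x (l +++ ?r)" using assms r by blast
  have yX: "y \<in> X" using \<tau> by (metis path_between_def pathfinish_in_path_image subsetD)
  have "homotopic_paths X (?r +++ (\<tau> +++ (l +++ ?r))) ((?r +++ \<tau>) +++ (l +++ ?r))"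
    by (rule homotopic_paths_sym, rule homotopic_assoc[OF r \<tau> lr])
  also have "homotopic_paths X \<dots> ((\<lambda>_. y) +++ (l +++ ?r))"
    using r \<tau> lr by (intro homotopic_join[OF path_between_join[OF r \<tau>] lr] homotopic_linv[OF \<tau>]) blast
  also have "homotopic_paths X \<dots> (l +++ ?r)"
    using lr by (intro homotopic_const_left) (auto simp: path_between_def)
  finally have 1: "homotopic_paths X (?r +++ (\<tau> +++ (l +++ ?r))) (l +++ ?r)" .
  have "homotopic_paths X ((k +++ ?r) +++ (\<tau> +++ (l +++ ?r))) (k +++ (?r +++ (\<tau> +++ (l +++ ?r))))"
    using assms r \<tau> by (intro homotopic_assoc) blast+
  also have "homotopic_paths X \<dots> (k +++ (l +++ ?r))"
    using assms(1) r \<tau> lr by (intro homotopic_join[OF assms(1) _ _ 1]) blast+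
  also have "homotopic_paths X \<dots> ((k +++ l) +++ ?r)"
    by (rule homotopic_paths_sym, rule homotopic_assoc[OF assms r])
  finally have 2: "homotopic_paths X ((k +++ ?r) +++ (\<tau> +++ (l +++ ?r))) ((k +++ l) +++ ?r)" .
  have kr: "path_between X y x (k +++ ?r)" and tlr: "path_between X x x (\<tau> +++ (l +++ ?r))"
    using assms r \<tau> lr by blast+
  have "homotopic_paths X ((\<tau> +++ (k +++ ?r)) +++ (\<tau> +++ (l +++ ?r))) (\<tau> +++ ((k +++ ?r) +++ (\<tau> +++ (l +++ ?r))))"
    by (rule homotopic_assoc[OF \<tau> kr tlr])
  also have "homotopic_paths X \<dots> (\<tau> +++ ((k +++ l) +++ ?r))"
    by (rule homotopic_join[OF \<tau> path_between_join[OF kr tlr] path_between_refl[OF \<tau>] 2])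
  finally show ?thesis
    unfolding base_change_def
    using mult_fundamental_group[OF base_change_loop[OF assms(1)] base_change_loop[OF assms(2)]]
      loop_class_eq_iff[OF path_between_join[OF base_change_loop[OF assms(1)] base_change_loop[OF assms(2)]]]
    by simp
qed

lemma base_change_const: "base_change X \<tau> (\<lambda>_. y) = \<one>\<^bsub>fundamental_group X x\<^esub>"
proof -
  have r: "path_between X y x (reversepath \<tau>)" by (rule path_between_reversepath[OF \<tau>])
  have yX: "y \<in> X" using \<tau> by (metis path_between_def pathfinish_in_path_image subsetD)
  have "homotopic_paths X (\<tau> +++ ((\<lambda>_. y) +++ reversepath \<tau>)) (\<tau> +++ reversepath \<tau>)"
    by (intro homotopic_join[OF \<tau> path_between_join[OF is_loop_const[OF yX] r]] path_between_refl[OF \<tau>]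
        homotopic_const_left) (use r in \<open>auto simp: path_between_def\<close>)
  also have "homotopic_paths X \<dots> (\<lambda>_. x)" by (rule homotopic_rinv[OF \<tau>])
  finally show ?thesis
    unfolding base_change_def one_fundamental_group
    by (subst loop_class_eq_iff[OF base_change_loop[OF is_loop_const[OF yX]]])
qed

lemma base_change_reversepath:
  assumes "is_loop X y l"
  shows "base_change X \<tau> (reversepath l) = inv\<^bsub>fundamental_group X x\<^esub> base_change X \<tau> l"
proof -
  have "x \<in> X" using \<tau> by (metis path_between_def pathstart_in_path_image subsetD)
  then interpret group "fundamental_group X x" by (rule group_fundamental_group)
  have r: "is_loop X y (reversepath l)" by (rule path_between_reversepath[OF assms])
  have "base_change X \<tau> (reversepath l) \<otimes>\<^bsub>fundamental_group X x\<^esub> base_change X \<tau> l =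
      \<one>\<^bsub>fundamental_group X x\<^esub>"
    unfolding base_change_mult[OF r assms]
    using base_change_cong[OF path_between_join[OF r assms] homotopic_linv[OF assms]] base_change_const
    by simp
  then show ?thesis
    using base_change_closed[OF r] base_change_closed[OF assms] by (simp add: inv_equality)
qed

end

text \<open>A free homotopy is a map of the square; the base point travels along \<open>\<tau>\<close>. Its first side is
  homotopic to the path along the other three sides, because the square is convex.\<close>

lemma homotopic_loops_imp_conjugate:
  assumes "homotopic_loops X p c" "pathstart p = x" "pathstart c = y"
  obtains \<tau> where "path_between X x y \<tau>" "homotopic_paths X p (\<tau> +++ (c +++ reversepath \<tau>))"
proof -
  obtain H where H: "continuous_on ({0..1::real} \<times> {0..1::real}) H" "H \<in> {0..1} \<times> {0..1} \<rightarrow> X"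
    "\<And>s. s \<in> {0..1} \<Longrightarrow> H (0, s) = p s" "\<And>s. s \<in> {0..1} \<Longrightarrow> H (1, s) = c s"
    "\<And>t. t \<in> {0..1} \<Longrightarrow> pathfinish (H \<circ> Pair t) = pathstart (H \<circ> Pair t)"
    using assms(1) unfolding homotopic_loops by auto
  let ?S = "{0..1::real} \<times> {0..1::real}"
  have conv: "convex ?S" by (intro convex_Times) auto
  define \<tau> where "\<tau> = H \<circ> linepath (0, 0) (1, 0)"
  have line: "path_between ?S a b (linepath a b)" if "a \<in> ?S" "b \<in> ?S" for a b
    using that conv by (simp add: path_between_def closed_segment_subset)
  have comp: "path_between X (H a) (H b) (H \<circ> p)" if "path_between ?S a b p" for a b p
    using that H(1,2) unfolding path_between_def
    by (auto simp: path_continuous_image continuous_on_subset path_image_compose pathstart_compose pathfinish_compose)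
  \<comment> \<open>the left side of the square against its other three sides\<close>
  have "homotopic_paths ?S (linepath (0, 0) (0, 1))
      (linepath (0, 0) (1, 0) +++ (linepath (1, 0) (1, 1) +++ linepath (1, 1) (0, 1)))"
    by (rule convex_homotopic_paths[OF conv line]) (auto intro!: path_between_join line)
  then have "homotopic_paths X (H \<circ> linepath (0, 0) (0, 1))
      (H \<circ> (linepath (0, 0) (1, 0) +++ (linepath (1, 0) (1, 1) +++ linepath (1, 1) (0, 1))))"
    by (rule homotopic_paths_continuous_image[OF _ H(1,2)])
  also have "H \<circ> (linepath (0, 0) (1, 0) +++ (linepath (1, 0) (1, 1) +++ linepath (1, 1) (0, 1))) =
      \<tau> +++ ((H \<circ> linepath (1, 0) (1, 1)) +++ (H \<circ> linepath (1, 1) (0, 1)))"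
    by (simp add: path_compose_join \<tau>_def)
  finally have 1: "homotopic_paths X (H \<circ> linepath (0, 0) (0, 1))
    (\<tau> +++ ((H \<circ> linepath (1, 0) (1, 1)) +++ (H \<circ> linepath (1, 1) (0, 1))))" .
  have lin: "linepath (a, b) (a', b') s = ((1 - s) * a + s * a', (1 - s) * b + s * b')" for a b a' b' s :: real
    by (simp add: linepath_def)
  have ends: "H (t, 0) = H (t, 1)" if "t \<in> {0..1}" for t
    using H(5)[OF that] by (simp add: pathstart_def pathfinish_def)
  have b: "H (0, 0) = x" "H (1, 0) = y" "H (1, 1) = y" "H (0, 1) = x"
    using assms(2,3) H(3)[of 0] H(4)[of 0] ends[of 0] ends[of 1] by (simp_all add: pathstart_def)
  have \<tau>: "path_between X x y \<tau>" unfolding \<tau>_def b[symmetric] by (intro comp line) auto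
  have c': "path_between X y y (H \<circ> linepath (1, 0) (1, 1))"
    using comp[OF line, of "(1, 0)" "(1, 1)"] b by simp
  have t': "path_between X y x (H \<circ> linepath (1, 1) (0, 1))"
    using comp[OF line, of "(1, 1)" "(0, 1)"] b by simp
  have p': "path_between X x x (H \<circ> linepath (0, 0) (0, 1))"
    using comp[OF line, of "(0, 0)" "(0, 1)"] b by simp
  have p: "homotopic_paths X (H \<circ> linepath (0, 0) (0, 1)) p"
    by (rule homotopic_paths_eq) (use p' H(3) in \<open>auto simp: path_between_def lin\<close>)
  have c: "homotopic_paths X (H \<circ> linepath (1, 0) (1, 1)) c"
    by (rule homotopic_paths_eq) (use c' H(4) in \<open>auto simp: path_between_def lin\<close>)
  have t: "homotopic_paths X (H \<circ> linepath (1, 1) (0, 1)) (reversepath \<tau>)"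
    by (rule homotopic_paths_eq)
      (use t' ends in \<open>auto simp: path_between_def lin \<tau>_def reversepath_def\<close>)
  have "homotopic_paths X p (H \<circ> linepath (0, 0) (0, 1))" by (rule homotopic_paths_sym[OF p])
  also note 1
  also have "homotopic_paths X (\<tau> +++ ((H \<circ> linepath (1, 0) (1, 1)) +++ (H \<circ> linepath (1, 1) (0, 1))))
      (\<tau> +++ (c +++ reversepath \<tau>))"
    by (rule homotopic_join[OF \<tau> path_between_join[OF c' t'] path_between_refl[OF \<tau>]
        homotopic_join[OF c' t' c t]])
  finally show thesis using that \<tau> by blast
qed

section \<open>Surfaces and products of commutators\<close>

fun concat_paths :: "'x \<Rightarrow> (nat \<Rightarrow> real \<Rightarrow> 'x::topological_space) \<Rightarrow> nat \<Rightarrow> real \<Rightarrow> 'x" where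
  "concat_paths x l 0 = (\<lambda>_. x)"
| "concat_paths x l (Suc n) = concat_paths x l n +++ l n"

lemma concat_paths_between:
  assumes "v 0 \<in> X" "\<And>k. k < n \<Longrightarrow> path_between X (v k) (v (Suc k)) (l k)"
  shows "path_between X (v 0) (v n) (concat_paths (v 0) l n)"
  using assms(2) by (induction n) (auto intro: is_loop_const assms(1) path_between_join)

lemma concat_paths_compose: "f \<circ> concat_paths x l n = concat_paths (f x) (\<lambda>k. f \<circ> l k) n"
proof (induction n)
  case (Suc n)
  show ?case by (simp only: concat_paths.simps path_compose_join Suc)
qed auto

text \<open>Read along the boundary of the polygon with side labels \<open>t\<close>, the four sides of each handle
  multiply to a commutator.\<close>

lemma (in group) surface_word:
  assumes "\<And>k. k < 4 * h \<Longrightarrow> t k \<in> carrier G"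
    and "C 0 = \<one>" "\<And>k. k < 4 * h \<Longrightarrow> C (Suc k) = C k \<otimes> t k"
    and "\<And>i. i < h \<Longrightarrow> t (4 * i + 2) = inv t (4 * i)"
    and "\<And>i. i < h \<Longrightarrow> t (4 * i + 3) = inv t (4 * i + 1)"
  shows "C (4 * h) = comm_prod (\<lambda>i. t (4 * i)) (\<lambda>i. t (4 * i + 1)) h"
    and "C (4 * h) \<in> comm_prods h"
proof -
  let ?a = "\<lambda>i. if i < h then t (4 * i) else \<one>" and ?b = "\<lambda>i. if i < h then t (4 * i + 1) else \<one>"
  have range: "range ?a \<subseteq> carrier G" "range ?b \<subseteq> carrier G" using assms(1) by auto
  have "C (4 * j) = comm_prod ?a ?b j" if "j \<le> h" for j
    using that
  proof (induction j)
    case (Suc j)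
    have "4 * Suc j = Suc (Suc (Suc (Suc (4 * j))))" by simp
    then have "C (4 * Suc j) = C (4 * j) \<otimes> t (4 * j) \<otimes> t (4 * j + 1) \<otimes> t (4 * j + 2) \<otimes> t (4 * j + 3)"
      using assms(3)[of "4 * j"] assms(3)[of "Suc (4 * j)"] assms(3)[of "Suc (Suc (4 * j))"]
        assms(3)[of "Suc (Suc (Suc (4 * j)))"] Suc.prems by (simp add: numeral_eq_Suc)
    then show ?case
      using Suc assms(1)[of "4 * j"] assms(1)[of "4 * j + 1"] assms(4,5)[of j] range by (simp add: m_assoc)
  qed (simp add: assms)
  then have *: "C (4 * h) = comm_prod ?a ?b h" by simp
  then show "C (4 * h) = comm_prod (\<lambda>i. t (4 * i)) (\<lambda>i. t (4 * i + 1)) h"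
    using comm_prod_cong[of h ?a "\<lambda>i. t (4 * i)" ?b "\<lambda>i. t (4 * i + 1)"] by simp
  show "C (4 * h) \<in> comm_prods h" by (rule comm_prodsI[OF range *])
qed

lemma path_between_polygon_side:
  assumes "n > 0"
  shows "path_between (cball 0 1) (cis (2 * pi * (k / n))) (cis (2 * pi * (Suc k / n))) (polygon_side n k)"
proof -
  have "path (polygon_side n k)"
    unfolding path_def polygon_side_def cis_conv_exp using assms by (intro continuous_intros) auto
  then show ?thesis
    by (auto simp: path_between_def path_image_def polygon_side_def pathstart_def pathfinish_def add.commute)
qed

lemma polygon_side_corners:
  "polygon_side n k 0 = cis (2 * pi * (k / n))" "polygon_side n k 1 = cis (2 * pi * (Suc k / n))"
  by (auto simp: polygon_side_def add.commute)

text \<open>The side pairings of the \<open>i\<close>-th handle identify its corners \<open>4i, \<dots>, 4i + 4\<close> with each other, and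
  consecutive handles share a corner.\<close>

lemma corners_identified:
  fixes k h :: nat
  assumes F: "\<And>x y. side_pairing h x y \<Longrightarrow> F x = F y" and "k \<le> 4 * h + 1"
  shows "F (cis (2 * pi * (real k / real (4 * h + 1)))) = F 1"
proof -
  define v where "v k = F (cis (2 * pi * (real k / real (4 * h + 1))))" for k :: nat
  have v: "v (4 * i + 1) = v (4 * i)" "v (4 * i + 2) = v (4 * i)" "v (4 * i + 3) = v (4 * i)"
    "v (4 * i + 4) = v (4 * i)" if "i < h" for i
  proof -
    have "v (4 * i) = v (4 * i + 3)" "v (4 * i + 1) = v (4 * i + 2)"
      using F[OF side_pairing.a[OF that, of 0]] F[OF side_pairing.a[OF that, of 1]]
      by (simp_all add: polygon_side_corners v_def add.commute)
    moreover have "v (4 * i + 1) = v (4 * i + 4)" "v (4 * i + 2) = v (4 * i + 3)"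
      using F[OF side_pairing.b[OF that, of 0]] F[OF side_pairing.b[OF that, of 1]]
      by (simp_all add: polygon_side_corners v_def add.commute)
    ultimately show "v (4 * i + 1) = v (4 * i)" "v (4 * i + 2) = v (4 * i)" "v (4 * i + 3) = v (4 * i)"
      "v (4 * i + 4) = v (4 * i)" by simp_all
  qed
  have base: "v (4 * i) = v 0" if "i \<le> h" for i :: nat
    using that v(4) by (induction i) (auto simp: add.commute)
  have "v k = v 0" if "k \<le> 4 * h" for k :: nat
  proof -
    define i where "i = k div 4"
    have "k = 4 * i \<or> (k = 4 * i + 1 \<or> k = 4 * i + 2 \<or> k = 4 * i + 3) \<and> i < h"
      using that unfolding i_def by presburger
    moreover have "i \<le> h" using that unfolding i_def by presburger
    ultimately show ?thesis using v[of i] base[of i] by auto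
  qed
  moreover have "v (4 * h + 1) = v 0" by (simp add: v_def)
  moreover have "v 0 = F 1" by (simp add: v_def)
  ultimately have "v k = F 1" using assms(2) by (metis Suc_eq_plus1 le_SucE)
  then show ?thesis by (simp only: v_def)
qed

text \<open>The boundary of the disc is null-homotopic in the disc, so the product of all side labels is
  trivial. The first \<open>4h\<close> labels form a product of \<open>h\<close> commutators, because paired sides carry
  inverse labels; the last label is freely homotopic to \<open>p\<close>.\<close>

theorem surface_boundary_comm_prods:
  assumes "x0 \<in> X" "is_loop X x0 p"
    and F: "continuous_on (cball 0 1) F" "F \<in> cball 0 1 \<rightarrow> X"
    and pairing: "\<And>x y. side_pairing h x y \<Longrightarrow> F x = F y"
    and "homotopic_loops X (F \<circ> polygon_side (4*h+1) (4*h)) p"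
  shows "loop_class X p \<in> monoid.comm_prods (fundamental_group X x0) h"
proof -
  interpret group "fundamental_group X x0" by (rule group_fundamental_group[OF assms(1)])
  define n where "n = 4 * h + 1"
  define y where "y = F 1"
  define v where "v k = cis (2 * pi * (real k / real n))" for k :: nat
  define \<sigma> where "\<sigma> = (\<lambda>k. F \<circ> polygon_side n k)"
  have Fv: "F (v k) = y" if "k \<le> n" for k
    using corners_identified[of h F k, OF pairing] that by (simp only: v_def n_def y_def)
  have side: "path_between (cball 0 1) (v k) (v (Suc k)) (polygon_side n k)" for k
    using path_between_polygon_side[of n k] by (simp add: v_def n_def)
  have comp: "path_between X (F a) (F b) (F \<circ> q)" if "path_between (cball 0 1) a b q" for a b q
    using that F unfolding path_between_def
    by (auto simp: path_continuous_image continuous_on_subset path_image_compose pathstart_compose pathfinish_compose)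
  have \<sigma>: "is_loop X y (\<sigma> k)" if "k < n" for k
    using comp[OF side[of k]] Fv[of k] Fv[of "Suc k"] that by (simp add: \<sigma>_def)
  have v0: "v 0 = 1" "v n = 1" by (simp_all add: v_def n_def)
  have prefix: "path_between (cball 0 1) (v 0) (v k) (concat_paths 1 (polygon_side n) k)" for k
    using concat_paths_between[of v "cball 0 1" k "polygon_side n"] side v0 by simp
  have C: "is_loop X y (concat_paths y \<sigma> k)" if "k \<le> n" for k
    using comp[OF prefix[of k]] Fv[of k] Fv[of 0] that
    by (simp add: concat_paths_compose \<sigma>_def y_def)
  have yX: "y \<in> X" using F(2) by (auto simp: y_def)
  have "homotopic_paths (cball 0 1) (concat_paths 1 (polygon_side n) n) (\<lambda>_. 1)"
    using prefix[of n] v0 by (intro convex_homotopic_paths[of _ 1 1] is_loop_const) auto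
  then have "homotopic_paths X (F \<circ> concat_paths 1 (polygon_side n) n) (F \<circ> (\<lambda>_. 1))"
    by (rule homotopic_paths_continuous_image[OF _ F])
  moreover have "F \<circ> (\<lambda>_::real. 1) = (\<lambda>_. y)" by (auto simp: y_def)
  ultimately have null: "homotopic_paths X (concat_paths y \<sigma> n) (\<lambda>_. y)"
    by (simp add: concat_paths_compose \<sigma>_def y_def)
  have "homotopic_loops X p (\<sigma> (4 * h))"
    using assms(6) unfolding \<sigma>_def n_def by (rule homotopic_loops_sym)
  then obtain \<tau> where \<tau>: "path_between X x0 y \<tau>"
    "homotopic_paths X p (\<tau> +++ (\<sigma> (4 * h) +++ reversepath \<tau>))"
    using homotopic_loops_imp_conjugate[of X p "\<sigma> (4 * h)" x0 y] assms(2) \<sigma>[of "4 * h"]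
    by (auto simp: path_between_def n_def)
  define t where "t k = base_change X \<tau> (\<sigma> k)" for k
  define D where "D k = base_change X \<tau> (concat_paths y \<sigma> k)" for k
  have t: "t k \<in> carrier (fundamental_group X x0)" if "k < n" for k
    unfolding t_def by (rule base_change_closed[OF \<tau>(1) \<sigma>[OF that]])
  have D: "D (Suc k) = D k \<otimes>\<^bsub>fundamental_group X x0\<^esub> t k" if "k < n" for k
    using base_change_mult[OF \<tau>(1) C \<sigma>] that by (simp add: D_def t_def)
  have inverse: "t (i + 2) = inv\<^bsub>fundamental_group X x0\<^esub> t i"
    if "i + 2 < n" and *: "\<And>s. s \<in> {0..1} \<Longrightarrow> side_pairing h (polygon_side n i s) (polygon_side n (i + 2) (1 - s))" for i
  proof -
    have "homotopic_paths X (\<sigma> (i + 2)) (reversepath (\<sigma> i))"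
    proof (rule homotopic_paths_eq)
      fix s :: real assume "s \<in> {0..1}"
      then show "\<sigma> (i + 2) s = reversepath (\<sigma> i) s"
        using pairing[OF *[of "1 - s"]] by (simp add: \<sigma>_def reversepath_def)
    qed (use \<sigma>[of "i + 2"] that in \<open>auto simp: path_between_def\<close>)
    then show ?thesis
      using base_change_cong[OF \<tau>(1) \<sigma>[OF that(1)]] base_change_reversepath[OF \<tau>(1) \<sigma>[of i]] that(1)
      by (simp add: t_def)
  qed
  have "D (4 * h) \<in> comm_prods h"
  proof (rule surface_word(2)[where t = t])
    show "D 0 = \<one>\<^bsub>fundamental_group X x0\<^esub>" by (simp add: D_def base_change_const[OF \<tau>(1)])
    show "t (4 * i + 2) = inv\<^bsub>fundamental_group X x0\<^esub> t (4 * i)" if "i < h" for i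
      using inverse[of "4 * i"] side_pairing.a[OF that] that by (simp add: n_def)
    show "t (4 * i + 3) = inv\<^bsub>fundamental_group X x0\<^esub> t (4 * i + 1)" if "i < h" for i
      using inverse[of "4 * i + 1"] side_pairing.b[OF that] that by (simp add: n_def numeral_eq_Suc)
  qed (use t D in \<open>auto simp: n_def\<close>)
  moreover have "D (4 * h) \<otimes>\<^bsub>fundamental_group X x0\<^esub> t (4 * h) = \<one>\<^bsub>fundamental_group X x0\<^esub>"
    using D[of "4 * h"] base_change_cong[OF \<tau>(1) C[of n] null] base_change_const[OF \<tau>(1)]
    by (simp add: D_def n_def)
  ultimately have "t (4 * h) = inv\<^bsub>fundamental_group X x0\<^esub> D (4 * h)"
    using t[of "4 * h"] comm_prods_subset by (metis inv_equality inv_inv less_add_one n_def subsetD inv_closed)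
  then have "t (4 * h) \<in> comm_prods h"
    using comm_prods_inv \<open>D (4 * h) \<in> comm_prods h\<close> by simp
  moreover have "loop_class X p = t (4 * h)"
    using \<tau>(2) assms(2) by (simp add: t_def base_change_def loop_class_eq_iff)
  ultimately show ?thesis by simp
qed

lemma quotient_topology_exists:
  fixes q :: "'a \<Rightarrow> 'b"
  obtains S where "quotient_map X S q"
proof -
  let ?P = "\<lambda>U. U \<subseteq> q ` topspace X \<and> openin X {x \<in> topspace X. q x \<in> U}"
  have "istopology ?P"
    unfolding istopology_def
  proof (intro conjI allI impI)
    fix A B assume "?P A" "?P B"
    moreover have "{x \<in> topspace X. q x \<in> A \<inter> B} = {x \<in> topspace X. q x \<in> A} \<inter> {x \<in> topspace X. q x \<in> B}"
      by auto
    ultimately show "openin X {x \<in> topspace X. q x \<in> A \<inter> B}" by (simp add: openin_Int)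
    show "A \<inter> B \<subseteq> q ` topspace X" using \<open>?P A\<close> by auto
  next
    fix \<K> assume *: "\<forall>K\<in>\<K>. ?P K"
    have "{x \<in> topspace X. q x \<in> \<Union>\<K>} = (\<Union>K\<in>\<K>. {x \<in> topspace X. q x \<in> K})" by auto
    then show "openin X {x \<in> topspace X. q x \<in> \<Union>\<K>}" using * by auto
    show "\<Union>\<K> \<subseteq> q ` topspace X" using * by auto
  qed
  then have open_iff: "openin (topology ?P) U \<longleftrightarrow> ?P U" for U by (simp add: topology_inverse')
  have top: "topspace (topology ?P) = q ` topspace X"
  proof
    have "{x \<in> topspace X. q x \<in> q ` topspace X} = topspace X" by auto
    then have "openin (topology ?P) (q ` topspace X)" using open_iff by simp
    then show "q ` topspace X \<subseteq> topspace (topology ?P)" by (rule openin_subset)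
    show "topspace (topology ?P) \<subseteq> q ` topspace X"
      using open_iff[of "topspace (topology ?P)"] by auto
  qed
  show thesis
    by (rule that[of "topology ?P"]) (auto simp: quotient_map_def top open_iff)
qed

text \<open>The quotient of the disc is realised on representatives: \<open>q\<close> picks one point in each class of
  glued points. A map on the disc that respects the gluing is then also the induced map on the
  surface.\<close>

lemma oriented_surface_exists:
  obtains S :: "complex topology" and q where "oriented_surface h S q"
    "\<And>x. equivclp (side_pairing h) x (q x)"
proof -
  define q where "q x = (SOME z. equivclp (side_pairing h) x z)" for x
  have q: "equivclp (side_pairing h) x (q x)" for x
    unfolding q_def by (rule someI[of _ x]) simp
  have "q x = q y \<longleftrightarrow> equivclp (side_pairing h) x y" for x y
  proof
    assume "q x = q y"
    then show "equivclp (side_pairing h) x y"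
      using q[of x] q[of y] by (metis equivclp_sym equivclp_trans)
  next
    assume *: "equivclp (side_pairing h) x y"
    have "equivclp (side_pairing h) x = equivclp (side_pairing h) y"
      by (intro ext) (metis * equivclp_sym equivclp_trans)
    then show "q x = q y" by (simp add: q_def)
  qed
  moreover obtain S where "quotient_map (top_of_set (cball 0 1)) S q"
    using quotient_topology_exists by blast
  ultimately show thesis using that q unfolding oriented_surface_def by blast
qed

text \<open>The null-homotopy is a map \<open>H\<close> of the unit square that is constant on three of its sides, so it
  factors through polar coordinates, which present the disc as a quotient of the square.\<close>

lemma nullhomotopic_loop_extends_to_disc:
  assumes "homotopic_paths X (\<lambda>_. x) \<gamma>"
  obtains F where "continuous_on (cball 0 1) F" "F \<in> cball 0 1 \<rightarrow> X"
    "\<And>t. t \<in> {0..1} \<Longrightarrow> F (cis (2 * pi * t)) = \<gamma> t"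
proof -
  obtain H where H: "continuous_on ({0..1::real} \<times> {0..1::real}) H" "H \<in> {0..1} \<times> {0..1} \<rightarrow> X"
    "\<And>s. s \<in> {0..1} \<Longrightarrow> H (0, s) = x" "\<And>s. s \<in> {0..1} \<Longrightarrow> H (1, s) = \<gamma> s"
    "\<And>t. t \<in> {0..1} \<Longrightarrow> H (t, 0) = x" "\<And>t. t \<in> {0..1} \<Longrightarrow> H (t, 1) = x"
    using assms unfolding homotopic_paths by (auto simp: pathstart_def pathfinish_def)
  let ?S = "{0..1::real} \<times> {0..1::real}"
  define pol where "pol = (\<lambda>(r::real, t::real). of_real r * cis (2 * pi * t))"
  \<comment> \<open>the radius is the homotopy parameter, the angle is the loop parameter\<close>
  define F where "F z = H (cmod z, Arg2pi z / (2 * pi))" for z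
  have arg: "Arg2pi z / (2 * pi) \<in> {0..1}" for z
    using Arg2pi_ge_0[of z] Arg2pi_lt_2pi[of z] by (auto simp: divide_simps)
  have F_pol: "F (pol (r, t)) = H (r, t)" if rt: "r \<in> {0..1}" "t \<in> {0..1}" for r t
  proof -
    have norm: "cmod (pol (r, t)) = r" using rt by (simp add: pol_def norm_mult)
    consider "r = 0" | "r > 0" "t < 1" | "t = 1" using rt by force
    then show ?thesis
    proof cases
      case 1
      then show ?thesis using H(3) rt by (simp add: F_def pol_def)
    next
      case 2
      have "Arg2pi (pol (r, t)) = 2 * pi * t"
        using 2 rt by (intro Arg2pi_unique[of r]) (auto simp: pol_def cis_conv_exp)
      then show ?thesis using norm by (simp add: F_def)
    next
      case 3
      then have "pol (r, t) = of_real r" by (simp add: pol_def)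
      then have "Arg2pi (pol (r, t)) = 0" using rt by (simp add: Arg2pi_of_real)
      then show ?thesis using norm H(5,6) rt 3 by (simp add: F_def)
    qed
  qed
  have cont: "continuous_map (top_of_set ?S) (top_of_set (cball 0 1)) pol"
  proof -
    have "continuous_on ?S pol"
      unfolding pol_def case_prod_beta cis_conv_exp by (intro continuous_intros)
    then show ?thesis by (auto simp: pol_def norm_mult)
  qed
  have surj: "pol ` ?S = cball 0 1"
  proof (intro equalityI subsetI)
    fix z :: complex assume z: "z \<in> cball 0 1"
    have "z = pol (cmod z, Arg2pi z / (2 * pi))"
      using Arg2pi_eq[of z] by (simp add: pol_def cis_conv_exp)
    then show "z \<in> pol ` ?S" using arg[of z] z by (intro image_eqI[of _ _ "(cmod z, Arg2pi z / (2 * pi))"]) auto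
  qed (auto simp: pol_def norm_mult)
  have compact: "compact_space (top_of_set ?S)"
    by (simp add: compact_space_subtopology compactin_euclidean_iff compact_Times)
  have "closed_map (top_of_set ?S) (top_of_set (cball 0 1)) pol"
    by (rule continuous_imp_closed_map[OF cont compact]) (simp add: Hausdorff_space_subtopology)
  then have quot: "quotient_map (top_of_set ?S) (top_of_set (cball 0 1)) pol"
    using continuous_closed_imp_quotient_map[OF cont] surj by simp
  have "continuous_map (top_of_set ?S) (top_of_set X) (F \<circ> pol)"
  proof (rule continuous_map_eq)
    show "continuous_map (top_of_set ?S) (top_of_set X) H" using H(1,2) by auto
  qed (use F_pol in auto)
  then have F: "continuous_map (top_of_set (cball 0 1)) (top_of_set X) F"
    using continuous_compose_quotient_map_eq[OF quot] by blast
  show thesis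
  proof (rule that[of F])
    show "F (cis (2 * pi * t)) = \<gamma> t" if "t \<in> {0..1}" for t
      using F_pol[of 1 t] H(4) that by (simp add: pol_def)
  qed (use F in auto)
qed

text \<open>Compares the two ways of running through \<open>n\<close> paths: iterated concatenation, which halves the
  parameter interval each time, and unit speed on the interval from \<open>0\<close> to \<open>n\<close>.\<close>

lemma concat_paths_homotopic_subdivided:
  fixes B :: "real \<Rightarrow> 'x::topological_space"
  assumes "continuous_on {0..real n} B" "B \<in> {0..real n} \<rightarrow> X"
    and "\<And>k. k < n \<Longrightarrow> is_loop X x (l k)" "B 0 = x"
    and "\<And>k s. k < n \<Longrightarrow> s \<in> {0..1} \<Longrightarrow> B (real k + s) = l k s"
  shows "homotopic_paths X (concat_paths x l n) (B \<circ> linepath 0 (real n))"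
  using assms(1,2,3,5)
proof (induction n)
  case 0
  have "B \<circ> linepath 0 (real 0) = (\<lambda>_. x)" using assms(4) by (auto simp: linepath_def)
  moreover have "x \<in> X" using "0.prems"(2) assms(4) by auto
  ultimately show ?case
    using is_loop_const[of x X] by (simp only: concat_paths.simps path_between_def homotopic_paths_refl)
next
  case (Suc n)
  have line: "path_between {0..real (Suc n)} a b (linepath a b)" if "a \<in> {0..real (Suc n)}" "b \<in> {0..real (Suc n)}" for a b
    using that by (auto simp: path_between_def closed_segment_eq_real_ivl)
  have "B \<circ> linepath (real n) (real (Suc n)) = (\<lambda>s. B (real n + s))"
    by (auto simp: linepath_def algebra_simps)
  moreover have "homotopic_paths X (l n) (\<lambda>s. B (real n + s))"
    by (rule homotopic_paths_eq) (use Suc.prems in \<open>auto simp: path_between_def\<close>)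
  moreover have "homotopic_paths X (concat_paths x l n) (B \<circ> linepath 0 (real n))"
    by (rule Suc.IH) (use Suc.prems in \<open>auto elim: continuous_on_subset\<close>)
  moreover have "path_between X x x (concat_paths x l n)"
  proof -
    have "x \<in> X" using Suc.prems(2) assms(4) by auto
    then show ?thesis using concat_paths_between[of "\<lambda>_. x" X n l] Suc.prems(3) by simp
  qed
  ultimately have "homotopic_paths X (concat_paths x l n +++ l n)
      ((B \<circ> linepath 0 (real n)) +++ (B \<circ> linepath (real n) (real (Suc n))))"
    using homotopic_join[of X x x "concat_paths x l n" x "l n"] Suc.prems(3) by simp
  also have "(B \<circ> linepath 0 (real n)) +++ (B \<circ> linepath (real n) (real (Suc n))) =
      B \<circ> (linepath 0 (real n) +++ linepath (real n) (real (Suc n)))"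
    by (simp only: path_compose_join)
  also have "homotopic_paths {0..real (Suc n)} (linepath 0 (real n) +++ linepath (real n) (real (Suc n)))
      (linepath 0 (real (Suc n)))"
    by (rule convex_homotopic_paths[OF _ path_between_join[OF line line] line]) auto
  then have "homotopic_paths X (B \<circ> (linepath 0 (real n) +++ linepath (real n) (real (Suc n))))
      (B \<circ> linepath 0 (real (Suc n)))"
    by (rule homotopic_paths_continuous_image[OF _ Suc.prems(1,2)])
  finally show ?case by (simp only: concat_paths.simps)
qed

text \<open>\<open>B\<close> runs through all loops at unit speed; it is continuous because every loop starts and ends
  at \<open>x\<close>.\<close>

lemma loops_on_polygon_sides_extend_to_disc:
  fixes l :: "nat \<Rightarrow> real \<Rightarrow> 'x::topological_space"
  assumes "n > 0" "\<And>k. is_loop X x (l k)" "homotopic_paths X (concat_paths x l n) (\<lambda>_. x)"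
  obtains F where "continuous_on (cball 0 1) F" "F \<in> cball 0 1 \<rightarrow> X"
    "\<And>k s. k < n \<Longrightarrow> s \<in> {0..1} \<Longrightarrow> F (polygon_side n k s) = l k s"
proof -
  define B where "B t = l (nat \<lfloor>t\<rfloor>) (t - of_int \<lfloor>t\<rfloor>)" for t
  have ends: "l k 0 = x" "l k 1 = x" for k
    using assms(2)[of k] by (auto simp: path_between_def pathstart_def pathfinish_def)
  have B: "B (real k + s) = l k s" if "s \<in> {0..1}" for k s
  proof (cases "s = 1")
    case True
    have "B (real k + 1) = l (Suc k) 0" by (simp add: B_def nat_add_distrib)
    then show ?thesis using True ends by simp
  next
    case False
    then have "\<lfloor>real k + s\<rfloor> = int k" using that by (simp add: floor_eq_iff)
    then show ?thesis by (simp add: B_def)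
  qed
  have piece: "continuous_on {real k..real (Suc k)} B" for k
  proof -
    have "continuous_on {real k..real (Suc k)} (l k \<circ> (\<lambda>t. t - real k))"
    proof (rule continuous_on_compose)
      have "(\<lambda>t. t - real k) ` {real k..real (Suc k)} = {0..1}"
        by (simp add: image_diff_atLeastAtMost)
      then show "continuous_on ((\<lambda>t. t - real k) ` {real k..real (Suc k)}) (l k)"
        using assms(2)[of k] by (simp add: path_between_def path_def)
    qed (intro continuous_intros)
    moreover have "B t = (l k \<circ> (\<lambda>t. t - real k)) t" if "t \<in> {real k..real (Suc k)}" for t
      using B[of "t - real k" k] that by simp
    ultimately show ?thesis by (metis (no_types, lifting) continuous_on_cong)
  qed
  have cover: "{0..real n} \<subseteq> (\<Union>k\<in>{..n}. {real k..real (Suc k)})"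
  proof
    fix t assume t: "t \<in> {0..real n}"
    then have "real (nat \<lfloor>t\<rfloor>) \<le> t" "t \<le> real (Suc (nat \<lfloor>t\<rfloor>))" "nat \<lfloor>t\<rfloor> \<le> n"
      by (auto simp: floor_le_iff nat_le_iff) linarith+
    then show "t \<in> (\<Union>k\<in>{..n}. {real k..real (Suc k)})" by auto
  qed
  have "continuous_on (\<Union>k\<in>{..n}. {real k..real (Suc k)}) B"
    by (intro continuous_on_closed_Union piece) auto
  then have cont: "continuous_on {0..real n} B" using cover continuous_on_subset by blast
  have "B t \<in> X" if t: "t \<in> {0..real n}" for t
  proof -
    obtain k where "t \<in> {real k..real (Suc k)}" using t cover by blast
    then show ?thesis
      using B[of "t - real k" k] assms(2)[of k] by (auto simp: path_between_def path_image_def)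
  qed
  then have "homotopic_paths X (concat_paths x l n) (B \<circ> linepath 0 (real n))"
    using cont assms(2) B ends B[of 0 0] by (intro concat_paths_homotopic_subdivided) auto
  then have "homotopic_paths X (\<lambda>_. x) (B \<circ> linepath 0 (real n))"
    using assms(3) homotopic_paths_sym homotopic_paths_trans by blast
  then obtain F where F: "continuous_on (cball 0 1) F" "F \<in> cball 0 1 \<rightarrow> X"
    "\<And>t. t \<in> {0..1} \<Longrightarrow> F (cis (2 * pi * t)) = (B \<circ> linepath 0 (real n)) t"
    using nullhomotopic_loop_extends_to_disc by metis
  have "F (polygon_side n k s) = l k s" if ks: "k < n" "s \<in> {0..1}" for k s
  proof -
    have "(real k + s) / real n \<in> {0..1}" using ks by (auto simp: divide_simps)
    then have "F (polygon_side n k s) = B (real k + s)"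
      using F(3)[of "(real k + s) / real n"] assms(1) by (simp add: polygon_side_def linepath_def)
    then show ?thesis using B ks by simp
  qed
  then show thesis using that F by blast
qed

text \<open>If \<open>p\<^sup>-\<^sup>1\<close> is homotopic to \<open>[\<alpha>\<^sub>0, \<beta>\<^sub>0] \<dots> [\<alpha>\<^sub>h\<^sub>-\<^sub>1, \<beta>\<^sub>h\<^sub>-\<^sub>1]\<close>, then labelling the sides of
  the polygon by these loops and the free side by \<open>p\<close> gives a null-homotopic boundary.\<close>

theorem comm_prods_bound_surface:
  assumes "x0 \<in> X" "is_loop X x0 p" "loop_class X p \<in> monoid.comm_prods (fundamental_group X x0) h"
  obtains F where "continuous_on (cball 0 1) F" "F \<in> cball 0 1 \<rightarrow> X"
    "\<And>x y. side_pairing h x y \<Longrightarrow> F x = F y"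
    "\<And>s. s \<in> {0..1} \<Longrightarrow> F (polygon_side (4*h+1) (4*h) s) = p s"
proof -
  interpret group "fundamental_group X x0" by (rule group_fundamental_group[OF assms(1)])
  let ?G = "fundamental_group X x0"
  have p: "loop_class X p \<in> carrier ?G" using assms(2) unfolding carrier_fundamental_group by blast
  have "inv\<^bsub>?G\<^esub> loop_class X p \<in> comm_prods h" by (rule comm_prods_inv[OF assms(3)])
  then obtain a b where ab: "range a \<subseteq> carrier ?G" "range b \<subseteq> carrier ?G"
    "inv\<^bsub>?G\<^esub> loop_class X p = comm_prod a b h" by (rule comm_prodsE)
  have "\<exists>l. is_loop X x0 l \<and> c i = loop_class X l" if "range c \<subseteq> carrier ?G" for c and i :: nat
    using that unfolding carrier_fundamental_group by (auto simp: image_subset_iff)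
  then obtain \<alpha> \<beta> where \<alpha>: "\<And>i. is_loop X x0 (\<alpha> i)" "\<And>i. a i = loop_class X (\<alpha> i)"
    and \<beta>: "\<And>i. is_loop X x0 (\<beta> i)" "\<And>i. b i = loop_class X (\<beta> i)"
    using ab(1,2) by metis
  define n where "n = 4 * h + 1"
  define l where "l k = (if k = 4 * h then p else if k mod 4 = 0 then \<alpha> (k div 4) else if k mod 4 = 1 then \<beta> (k div 4)
    else if k mod 4 = 2 then reversepath (\<alpha> (k div 4)) else reversepath (\<beta> (k div 4)))" for k
  have l: "is_loop X x0 (l k)" for k
    using \<alpha> \<beta> assms(2) by (simp add: l_def path_between_reversepath)
  have l_eq: "l (4 * i) = \<alpha> i" "l (4 * i + 1) = \<beta> i" "l (4 * i + 2) = reversepath (\<alpha> i)"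
    "l (4 * i + 3) = reversepath (\<beta> i)" if "i < h" for i
  proof -
    have "4 * i \<noteq> 4 * h" "4 * i + 1 \<noteq> 4 * h" "4 * i + 2 \<noteq> 4 * h" "4 * i + 3 \<noteq> 4 * h" using that by presburger+
    moreover have "(4 * i + 1) mod 4 = 1" "(4 * i + 2) mod 4 = 2" "(4 * i + 3) mod 4 = 3"
      "(4 * i + 1) div 4 = i" "(4 * i + 2) div 4 = i" "(4 * i + 3) div 4 = i" by presburger+
    ultimately show "l (4 * i) = \<alpha> i" "l (4 * i + 1) = \<beta> i" "l (4 * i + 2) = reversepath (\<alpha> i)"
      "l (4 * i + 3) = reversepath (\<beta> i)" by (simp_all add: l_def)
  qed
  have inv_class: "loop_class X (reversepath q) = inv\<^bsub>?G\<^esub> loop_class X q" if q: "is_loop X x0 q" for q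
  proof -
    have r: "is_loop X x0 (reversepath q)" by (rule path_between_reversepath[OF q])
    have "loop_class X (reversepath q) \<otimes>\<^bsub>?G\<^esub> loop_class X q = \<one>\<^bsub>?G\<^esub>"
      unfolding mult_fundamental_group[OF r q] one_fundamental_group
      using homotopic_linv[OF q] loop_class_eq_iff[OF path_between_join[OF r q]] by blast
    moreover have "loop_class X q \<in> carrier ?G" "loop_class X (reversepath q) \<in> carrier ?G"
      using q r unfolding carrier_fundamental_group by blast+
    ultimately show ?thesis by (simp add: inv_equality)
  qed
  define t where "t k = loop_class X (l k)" for k
  define C where "C k = loop_class X (concat_paths x0 l k)" for k
  have t: "t k \<in> carrier ?G" for k using l unfolding t_def carrier_fundamental_group by blast
  have loop: "is_loop X x0 (concat_paths x0 l k)" for k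
    using concat_paths_between[of "\<lambda>_. x0" X k l] assms(1) l by simp
  have CS: "C (Suc k) = C k \<otimes>\<^bsub>?G\<^esub> t k" for k
    by (simp add: C_def t_def mult_fundamental_group[OF loop l])
  have "C (4 * h) = comm_prod (\<lambda>i. t (4 * i)) (\<lambda>i. t (4 * i + 1)) h"
  proof (rule surface_word(1))
    show "C 0 = \<one>\<^bsub>?G\<^esub>" by (simp add: C_def one_fundamental_group)
    show "t (4 * i + 2) = inv\<^bsub>?G\<^esub> t (4 * i)" "t (4 * i + 3) = inv\<^bsub>?G\<^esub> t (4 * i + 1)" if "i < h" for i
      using l_eq[OF that] inv_class \<alpha> \<beta> by (simp_all add: t_def)
  qed (use t CS in auto)
  also have "\<dots> = comm_prod a b h"
    using l_eq \<alpha> \<beta> by (intro comm_prod_cong) (simp_all add: t_def)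
  finally have "C (4 * h) = inv\<^bsub>?G\<^esub> loop_class X p" using ab(3) by simp
  moreover have "t (4 * h) = loop_class X p" by (simp add: t_def l_def)
  ultimately have "C n = \<one>\<^bsub>?G\<^esub>" using CS[of "4 * h"] p by (simp add: n_def)
  then have "homotopic_paths X (concat_paths x0 l n) (\<lambda>_. x0)"
    unfolding C_def one_fundamental_group using loop_class_eq_iff[OF loop] by blast
  then obtain F where F: "continuous_on (cball 0 1) F" "F \<in> cball 0 1 \<rightarrow> X"
    "\<And>k s. k < n \<Longrightarrow> s \<in> {0..1} \<Longrightarrow> F (polygon_side n k s) = l k s"
    using loops_on_polygon_sides_extend_to_disc[of n X x0 l] l by (auto simp: n_def)
  show thesis
  proof (rule that[OF F(1,2)])
    show "F x = F y" if "side_pairing h x y" for x y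
      using that
    proof cases
      case (a i s)
      then show ?thesis
        using F(3)[of "4 * i" s] F(3)[of "4 * i + 2" "1 - s"] l_eq[of i] by (simp add: n_def reversepath_def)
    next
      case (b i s)
      then show ?thesis
        using F(3)[of "4 * i + 1" s] F(3)[of "4 * i + 3" "1 - s"] l_eq[of i] by (simp add: n_def reversepath_def)
    qed
    show "F (polygon_side (4 * h + 1) (4 * h) s) = p s" if "s \<in> {0..1}" for s
      using F(3)[of "4 * h" s] that by (simp add: n_def l_def)
  qed
qed

section \<open>Stable commutator length\<close>

text \<open>Fekete's lemma; the limit is the infimum of the quotients over \<open>n \<ge> 1\<close>.\<close>

lemma fekete:
  fixes a :: "nat \<Rightarrow> nat"
  assumes "\<And>m n. a (m + n) \<le> a m + a n"
  shows "convergent (\<lambda>n. real (a n) / real n)"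
proof -
  define L where "L = (INF n\<in>{1..}. real (a n) / real n)"
  have bdd: "bdd_below ((\<lambda>n. real (a n) / real n) ` {1..})" by (rule bdd_belowI[of _ 0]) auto
  have L_le: "L \<le> real (a n) / real n" if "n \<ge> 1" for n
    unfolding L_def using bdd that by (intro cINF_lower) auto
  have mult: "a (q * k) \<le> q * a k + a 0" for q k
  proof (induction q)
    case (Suc q)
    then show ?case using assms[of k "q * k"] by simp
  qed simp
  have "(\<lambda>n. real (a n) / real n) \<longlonglongrightarrow> L"
  proof (rule LIMSEQ_I)
    fix e :: real assume e: "e > 0"
    \<comment> \<open>choose an index whose quotient nearly attains the infimum and divide every large index by it with remainder\<close>
    have "\<exists>x\<in>(\<lambda>n. real (a n) / real n) ` {1..}. x < L + e / 2"
      using e bdd unfolding L_def by (intro iffD1[OF cInf_less_iff]) auto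
    then obtain k where k: "k \<ge> 1" "real (a k) / real k < L + e / 2" by auto
    define M where "M = Max (a ` {..<k}) + a 0"
    obtain n0 :: nat where n0: "real n0 > 2 * real M / e" using reals_Archimedean2 by blast
    have "\<bar>real (a n) / real n - L\<bar> < e" if n: "n \<ge> max 1 n0" for n
    proof -
      have npos: "real n > 0" using n by simp
      define q r where "q = n div k" and "r = n mod k"
      have qr: "n = q * k + r" "r < k" using k(1) by (simp_all add: q_def r_def)
      have "a n \<le> a (q * k) + a r" using assms[of "q * k" r] qr(1) by simp
      also have "\<dots> \<le> q * a k + M"
      proof -
        have "a r \<le> Max (a ` {..<k})" using qr(2) by simp
        then show ?thesis using mult[of q k] by (simp add: M_def)
      qed
      finally have "real (a n) \<le> real q * real (a k) + real M"
        by (metis of_nat_add of_nat_le_iff of_nat_mult)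
      also have "real q * real (a k) = (real q * real k) * (real (a k) / real k)"
        using k(1) by simp
      also have "\<dots> \<le> real n * (real (a k) / real k)"
      proof (rule mult_right_mono)
        have "q * k \<le> n" using qr(1) by simp
        then show "real q * real k \<le> real n" by (metis of_nat_le_iff of_nat_mult)
      qed simp
      also have "\<dots> \<le> real n * (L + e / 2)" using k(2) by (intro mult_left_mono) auto
      finally have "real (a n) / real n \<le> (real n * (L + e / 2) + real M) / real n"
        using npos by (intro divide_right_mono) auto
      also have "\<dots> = L + e / 2 + real M / real n" using npos by (simp add: field_simps)
      also have "real M / real n < e / 2"
      proof -
        have "real n > 2 * real M / e" using n n0 by (smt (verit) max.bounded_iff of_nat_le_iff)
        then show ?thesis using e npos by (simp add: field_simps)
      qed
      finally show ?thesis using L_le[of n] n e by (simp add: abs_if)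
    qed
    then show "\<exists>no. \<forall>n\<ge>no. norm (real (a n) / real n - L) < e"
      unfolding real_norm_def by blast
  qed
  then show ?thesis by (rule convergentI)
qed

lemma hom_comm_prods:
  assumes "group G" "group H" "\<phi> \<in> hom G H" "x \<in> monoid.comm_prods G n"
  shows "\<phi> x \<in> monoid.comm_prods H n"
proof -
  interpret G: group G by fact
  interpret H: group H by fact
  interpret group_hom G H \<phi> using assms(3) by (simp add: group_hom_axioms_def group_hom.intro G.is_group H.is_group)
  obtain a b where ab: "range a \<subseteq> carrier G" "range b \<subseteq> carrier G" "x = G.comm_prod a b n"
    using assms(4) by (rule G.comm_prodsE)
  have "\<phi> (G.comm_prod a b m) = H.comm_prod (\<phi> \<circ> a) (\<phi> \<circ> b) m" for m
  proof (induction m)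
    case (Suc m)
    have "a m \<in> carrier G" "b m \<in> carrier G" using ab by auto
    then show ?case using Suc ab by simp
  qed simp
  then show ?thesis using ab by (intro H.comm_prodsI[of "\<phi> \<circ> a" "\<phi> \<circ> b"]) auto
qed

lemma iso_comm_prods:
  assumes "group G" "group H" "\<phi> \<in> iso G H" "g \<in> carrier G"
  shows "\<phi> g \<in> monoid.comm_prods H n \<longleftrightarrow> g \<in> monoid.comm_prods G n"
proof -
  have "\<phi> \<in> hom G H" "inv_into (carrier G) \<phi> \<in> hom H G"
    using assms group.iso_set_sym[OF assms(1,3)] by (auto simp: iso_def)
  moreover have "inv_into (carrier G) \<phi> (\<phi> g) = g"
    using assms by (auto simp: iso_def bij_betw_def inv_into_f_f)
  ultimately show ?thesis
    using hom_comm_prods[OF assms(1,2)] hom_comm_prods[OF assms(2,1)] by metis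
qed

lemma bounds_genus_iff_comm_prods:
  assumes "x0 \<in> X" "\<phi> g \<in> carrier (fundamental_group X x0)"
  shows "bounds_genus X \<phi> g h \<longleftrightarrow> \<phi> g \<in> monoid.comm_prods (fundamental_group X x0) h"
proof
  obtain p0 where p0: "is_loop X x0 p0" "\<phi> g = loop_class X p0"
    using assms(2) unfolding carrier_fundamental_group by auto
  {
    assume "bounds_genus X \<phi> g h"
    then obtain S :: "complex topology" and q f p where S: "oriented_surface h S q"
      "continuous_map S (top_of_set X) f" "p \<in> \<phi> g" "homotopic_loops X (f \<circ> boundary_loop h q) p"
      unfolding bounds_genus_def by blast
    have p: "homotopic_paths X p0 p" using S(3) p0(2) by (simp add: loop_class_def)
    then have loop: "is_loop X x0 p" by (rule path_between_cong[OF p0(1)])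
    have "\<phi> g = loop_class X p" using p p0 loop_class_eq_iff by blast
    have quot: "quotient_map (top_of_set (cball 0 1)) S q"
      and eq: "\<And>x y. x \<in> cball 0 1 \<Longrightarrow> y \<in> cball 0 1 \<Longrightarrow> q x = q y \<longleftrightarrow> equivclp (side_pairing h) x y"
      using S(1) unfolding oriented_surface_def by auto
    have "continuous_map (top_of_set (cball 0 1)) (top_of_set X) (f \<circ> q)"
      using quot S(2) continuous_compose_quotient_map_eq by blast
    then have F: "continuous_on (cball 0 1) (f \<circ> q)" "f \<circ> q \<in> cball 0 1 \<rightarrow> X" by auto
    have side: "cmod (polygon_side n k s) = 1" for n k s by (simp add: polygon_side_def)
    have pair: "(f \<circ> q) x = (f \<circ> q) y" if xy: "side_pairing h x y" for x y
    proof -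
      have "x \<in> cball 0 1" "y \<in> cball 0 1" using xy by (auto elim!: side_pairing.cases simp: side)
      then have "q x = q y" using eq xy by (simp add: r_into_equivclp)
      then show ?thesis by simp
    qed
    have "f \<circ> boundary_loop h q = (f \<circ> q) \<circ> polygon_side (4 * h + 1) (4 * h)"
      by (auto simp: boundary_loop_def)
    then have bd: "homotopic_loops X ((f \<circ> q) \<circ> polygon_side (4 * h + 1) (4 * h)) p"
      using S(4) by (simp only:)
    show "\<phi> g \<in> monoid.comm_prods (fundamental_group X x0) h"
      unfolding \<open>\<phi> g = loop_class X p\<close>
      by (rule surface_boundary_comm_prods[OF assms(1) loop F pair bd])
  }
  {
    assume "\<phi> g \<in> monoid.comm_prods (fundamental_group X x0) h"
    then have mem: "loop_class X p0 \<in> monoid.comm_prods (fundamental_group X x0) h" by (simp only: p0(2))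
    obtain F where F: "continuous_on (cball 0 1) F" "F \<in> cball 0 1 \<rightarrow> X"
      "\<And>x y. side_pairing h x y \<Longrightarrow> F x = F y"
      "\<And>s. s \<in> {0..1} \<Longrightarrow> F (polygon_side (4*h+1) (4*h) s) = p0 s"
      using comm_prods_bound_surface[OF assms(1) p0(1) mem] by blast
    obtain S :: "complex topology" and q where S: "oriented_surface h S q"
      and q: "\<And>x. equivclp (side_pairing h) x (q x)" using oriented_surface_exists by blast
    have eqF: "F x = F y" if "equivclp (side_pairing h) x y" for x y
      using that by (induction rule: equivclp_induct) (auto dest: F(3))
    have Fq: "F \<circ> q = F" using eqF[OF q] by (simp add: fun_eq_iff)
    have "continuous_map S (top_of_set X) F"
      using S F(1,2) Fq continuous_compose_quotient_map[of "top_of_set (cball 0 1)" S q "top_of_set X" F]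
      unfolding oriented_surface_def by auto
    moreover have "homotopic_loops X (F \<circ> boundary_loop h q) p0"
    proof (rule homotopic_loops_sym, rule homotopic_loops_eq)
      show "p0 t = (F \<circ> boundary_loop h q) t" if "t \<in> {0..1}" for t
        using F(4)[OF that] fun_cong[OF Fq, of "polygon_side (4*h+1) (4*h) t"]
        by (simp add: boundary_loop_def)
    qed (use p0(1) in \<open>auto simp: path_between_def\<close>)
    moreover have "p0 \<in> \<phi> g" using p0 by (simp add: loop_class_def path_between_def)
    ultimately show "bounds_genus X \<phi> g h" unfolding bounds_genus_def using S by blast
  }
qed

theorem theorem1p2:
  fixes V :: "'v set" and E :: "'v set set"
    and X :: "'x::topological_space set" and x0 :: 'x
    and \<phi> :: "'v word set \<Rightarrow> (real \<Rightarrow> 'x) set"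
    and g :: "'v word set"
  assumes "finite_simplicial_graph V E"
    and "triangle_free E"
    and "path_connected X" and "x0 \<in> X"
    and "\<phi> \<in> iso (raag V E) (fundamental_group X x0)"
    and "g \<in> carrier (raag V E)"
    and "g \<noteq> \<one>\<^bsub>raag V E\<^esub>"
  shows "scl (raag V E) X \<phi> g \<ge> ereal (1 / 20)"
proof -
  let ?G = "raag V E"
  interpret artin_graph V E ?G using assms(1) by unfold_locales simp_all
  have bounds: "bounds_genus X \<phi> x h \<longleftrightarrow> x \<in> comm_prods h" if "x \<in> carrier ?G" for x h
  proof -
    have x: "\<phi> x \<in> carrier (fundamental_group X x0)"
      using assms(5) that by (auto simp: iso_def hom_def)
    show ?thesis
      using bounds_genus_iff_comm_prods[where \<phi> = \<phi> and g = x and h = h, OF assms(4) x]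
        iso_comm_prods[OF is_group group_fundamental_group[OF assms(4)] assms(5) that, of h] by simp
  qed
  define cl where "cl = commutator_length X \<phi>"
  have cl_eq: "cl x = (LEAST h. x \<in> comm_prods h)" if "x \<in> carrier ?G" for x
  proof -
    have "bounds_genus X \<phi> x = (\<lambda>h. x \<in> comm_prods h)" using bounds[OF that] by blast
    then show ?thesis by (simp add: cl_def commutator_length_def)
  qed
  have cl_mem: "x \<in> comm_prods (cl x)" if x: "x \<in> derived ?G (carrier ?G)" for x
  proof -
    obtain h where h: "x \<in> comm_prods h" using x unfolding derived_eq_comm_prods by blast
    then have "x \<in> carrier ?G" using comm_prods_subset[of h] by blast
    then show ?thesis using cl_eq[of x] LeastI[of "\<lambda>h. x \<in> comm_prods h", OF h] by simp
  qed
  have cl_le: "cl x \<le> h" if "x \<in> comm_prods h" for x h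
  proof -
    have "x \<in> carrier ?G" using that comm_prods_subset[of h] by blast
    then show ?thesis using cl_eq[of x] Least_le[of "\<lambda>h. x \<in> comm_prods h" h] that by simp
  qed
  show ?thesis
  proof (cases "\<exists>n\<ge>1. g [^]\<^bsub>?G\<^esub> (n::nat) \<in> derived ?G (carrier ?G)")
    case False
    show ?thesis unfolding scl_def if_not_P[OF False] by simp
  next
    case True
    define N where "N = (LEAST n::nat. n \<ge> 1 \<and> g [^]\<^bsub>?G\<^esub> n \<in> derived ?G (carrier ?G))"
    have N: "N \<ge> 1" "g [^]\<^bsub>?G\<^esub> N \<in> derived ?G (carrier ?G)"
      using LeastI_ex[OF True[unfolded Bex_def]] unfolding N_def by simp_all
    define y where "y = g [^]\<^bsub>?G\<^esub> N"
    have y: "y \<in> carrier ?G" using assms(6) by (simp add: y_def)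
    interpret D: subgroup "derived ?G (carrier ?G)" ?G by (rule derived_is_subgroup) simp
    have pow: "y [^]\<^bsub>?G\<^esub> n \<in> derived ?G (carrier ?G)" for n :: nat
      by (induction n) (use N in \<open>auto simp: y_def\<close>)
    define a where "a n = cl (y [^]\<^bsub>?G\<^esub> n)" for n :: nat
    have sub: "a (m + n) \<le> a m + a n" for m n
      unfolding a_def using cl_mem[OF pow] y
      by (intro cl_le) (simp add: comm_prods_mult flip: nat_pow_mult)
    have conv: "(\<lambda>n. real (a n) / real n) \<longlonglongrightarrow> lim (\<lambda>n. real (a n) / real n)"
      using fekete[of a] sub by (simp add: convergent_LIMSEQ_iff)
    have lower: "real N / 12 \<le> real (a n) / real n" if "n \<ge> 1" for n
    proof -
      have "g [^]\<^bsub>?G\<^esub> (N * n) \<in> comm_prods (a n)"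
        using cl_mem[OF pow, of n] assms(6) by (simp add: a_def y_def nat_pow_pow)
      then have "N * n \<le> 12 * a n" using commutator_gap assms(6,7) by blast
      then have "real N * real n \<le> 12 * real (a n)" by (metis of_nat_le_iff of_nat_mult of_nat_numeral)
      then show ?thesis using that by (simp add: field_simps)
    qed
    have "real N / 12 \<le> lim (\<lambda>n. real (a n) / real n)"
      by (rule tendsto_lowerbound[OF conv]) (use lower in \<open>auto intro!: eventually_sequentiallyI\<close>)
    then have "1 / 20 \<le> lim (\<lambda>n. real (a n) / real n) / real N"
      using N(1) by (simp add: field_simps)
    moreover have "scl ?G X \<phi> g = ereal (lim (\<lambda>n. real (a n) / real n) / real N)"
      using True by (simp add: scl_def scl_derived_def a_def cl_def y_def N_def Let_def)
    ultimately show ?thesis by simp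
  qed
qed

end
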